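(* Consider the stochastic event system $\mathsf{SeS}_{\mathsf{VC}}=(\zeta,\mathcal Q)$ of a semi-dynamic vehicular cloud with $n$ deployed groups, and the $\beta$-SMP with state space $\mathcal S=\{S_0,S_1,\dots,S_n,F\}$ (all defined in the context). Let $X\in\mathcal S$ and $X'\in\mathcal S$ denote the current and the next state of the $\beta$-SMP, and let $e_X\in\zeta$ denote the event that occurs in the current state $X$. Each state $S_i$, except for $S_n$, can be decomposed into $i+2$ states (called H-states). Precisely: - $S_0\equiv S_{0,0}$ when $S_0$ is the initial state; - $X'=S_0\equiv S_{0,1}$ if $X=S_1$ and $e_X=e^{\mathsf R}(C_\ell)$ with $C_\ell\in\dot{\mathcal C}_1$; - for $1\le i\le n-1$: $X'=S_i\equiv S_{i,0}$ if $X=S_{i-1}$ and $e_X=e^{\mathsf D}(C_\ell)$, for every $C_\ell\in\ddot{\mathcal C}_{2n-2(i-1)}$; and, for each $j\in\{1,\dots,i+1\}$, $X'=S_i\equiv S_{i,j}$ if $X=S_{i+1}$, $e_X=e^{\mathsf R}(C_\ell)$ and $O(C_\ell)=j$, for every $C_\ell\in\dot{\mathcal C}_{i+1}$; - $X'=S_n\equiv S_{n,0}$ if $X=S_{n-1}$ and $e_X=e^{\mathsf D}(C_\ell)$, for every $C_\ell\in\ddot{\mathcal C}_2$. Here the H-states are the following pairs (list of residual sojourn times of the vehicles processing the groups; list of residual recruitment durations of the recruiters): $$S_{0,0}=\{[Z_1,\dots,Z_{2n}],[\,]\},\qquad S_{0,1}=\{\mathcal L_2^{(\ddot{\mathfrak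 X})}\langle 2n\rangle,[\,]\},$$ $$S_{i,0}=\{\mathcal L_1^{(\dot{\mathfrak X})}\langle 2n-i\rangle,\ \mathcal H_1^{(\varphi;\mathfrak R)}\langle i-1;1\rangle\}\quad(1\le i\le n),$$ $$S_{i,j}=\{\mathcal L_2^{(\ddot{\mathfrak X})}\langle 2n-i\rangle,\ \mathcal H_2^{(\gamma;\psi)}\langle j-1;\,i-(j-1)\rangle\}\quad(1\le i\le n-1,\ 1\le j\le i+1),$$ where $Z_1,\dots,Z_{2n}$ are i.i.d. with distribution $\mathfrak D_Z$ and $[\,]$ is the empty list. Moreover $\mathcal L_1^{(\dot{\mathfrak X})}\langle 2n-i\rangle\,\dot{\preceq}\,\mathcal H_1^{(\varphi;\mathfrak R)}\langle i-1;1\rangle$ and $\mathcal L_2^{(\ddot{\mathfrak X})}\langle 2n-i\rangle\,\dot{\preceq}\,\mathcal H_2^{(\gamma;\psi)}\langle j-1;\,i-(j-1)\rangle$.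
   Context: **Vehicular cloud model.** An application is partitioned into groups of sub-tasks; at the time considered, $n$ groups are deployed on vehicles of a vehicular cloud (VC). Initially each group is processed by two distinct vehicles, and each vehicle processes one group. Let $\mathcal C$ be the set of vehicles used. Vehicle $C_\ell$ has sojourn time $Z_\ell$ (i.i.d., general distribution $\mathfrak D_Z$) and recruitment duration $U_\ell$ (i.i.d., general distribution $\mathfrak R=\mathfrak R_U$); all these variables are independent and positive. When one of the two vehicles of a group departs, the remaining vehicle becomes a recruiter and immediately starts recruiting a replacement, which takes its recruitment duration; the recruited vehicle is chosen among vehicles that were already in the VC when processing started (a sufficiently large supply is assumed). When recruitment completes, the group has two vehicles again. If a recruiter departs before completing its recruitment, the application fails. $\mathsf{SeS}_{\mathsf{VC}}=(\zeta,\mathcal Q)$ has event set $\zeta=\{e^{\mathsf D}(C_\ell),e^{\mathsf R}(C_\ell)\}_{C_\ell\in\mathcal C}$ and $\mathcal Q=\{Z_\ell\}\cup\{U_\ell\}$, where $e^{\mathsf D}(C_\ell)$ is "vehicle $C_\ell$ departs the VC" and $e^{\mathsf R}(C_\ell)$ is "vehicle $C_\ell$ completes its recruitment". **$\beta$-SMP.** State $S_i=\dot{\mathcal C}_i\cup\ddot{\mathcal C}_{2n-2i}$, $0\le i\le n$: $i$ groups have exactly one vehicle, these $i$ vehicles (all recruiters) forming $\dot{\mathcal C}_i$, and the other $n-i$ groups have two vehicles, these $2n-2i$ vehicles forming $\ddot{\mathcal C}_{2n-2i}$. $F$ is the failure state; $S_0$ is the initial state. From $S_i$, departure of a vehicle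 of $\ddot{\mathcal C}_{2n-2i}$ leads to $S_{i+1}$, completion of a recruitment by a vehicle of $\dot{\mathcal C}_i$ leads to $S_{i-1}$, and departure of a vehicle of $\dot{\mathcal C}_i$ leads to $F$. After each event, the time elapsed since the previous event is subtracted from all residual sojourn times and residual recruitment durations. **Event dynamic variables (EDV).** For random variables $M,N>0$ with $M>N$, $V=M-N$ is called an EDV and its distribution an e-distribution; $M,N$ may themselves be EDVs, and being an EDV refers to the representation $M-N$. A positive random variable not so represented is a simple random variable (SRV). Duration: $\hat\Gamma(V)=\hat\Gamma(M)$ if $V=M-N$ is an EDV, $\hat\Gamma(V)=V$ if $V$ is an SRV. Reducer: $\hat\delta(V)=\hat\delta(M)+(N+\hat\delta(N))$ if $V=M-N$ is an EDV, $\hat\delta(V)=0$ if $V$ is an SRV. Pivot: $\hat\xi(V)=V+\hat\delta(V)-\hat\Gamma(V)$. For EDVs $V_1,V_2$ with $\hat\Gamma(V_1)\ne\hat\Gamma(V_2)$: $V_1\dot{\preceq}V_2$ iff $\hat\delta(V_1)=\hat\delta(V_2)$ and $\hat\xi(V_1)\le\hat\xi(V_2)$; by convention $V_1\dot{\preceq}V_2$ if $V_1$ is an EDV and $V_2$ an SRV. **Special e-distributions.** With $Z_1,Z_2\sim\mathfrak D_Z$ and $U\sim\mathfrak R$ independent: $\dot{\mathfrak X}$ is the distribution of the EDV $Z_1-Z_2$; $\ddot{\mathfrak X}$ that of the EDV $Z_1-(Z_2+U)$; $\varphi$ that of the EDV $W=U-Z'$ with $Z'\sim\dot{\mathfrak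 X}$; $\psi$ that of the EDV $U-W$ with $W\sim\varphi$; $\gamma$ that of the EDV $W-U$ with $W\sim\varphi$. "$V\sim\alpha$" means that $V$ is an EDV of the corresponding form. **Lists.** An event dynamic list (EDL) $\mathcal L^{(\alpha)}\langle m\rangle=[V_1,\dots,V_m]$ is a list of $m$ EDVs, each following $\alpha$, with $V_a\dot{\preceq}V_b$ for $a<b$. For two lists, $\mathcal L_1\dot{\preceq}\mathcal L_2$ means $V\dot{\preceq}V'$ for all $V\in\mathcal L_1$, $V'\in\mathcal L_2$. $\mathcal H^{(\alpha;\alpha')}\langle a;b\rangle$ is the concatenation of $\mathcal L_1^{(\alpha)}\langle a\rangle$ followed by $\mathcal L_2^{(\alpha')}\langle b\rangle$, where $\mathcal L_1^{(\alpha)}\langle a\rangle\dot{\preceq}\mathcal L_2^{(\alpha')}\langle b\rangle$; in $\mathcal H^{(\varphi;\mathfrak R)}\langle i-1;1\rangle$ the first $i-1$ entries follow $\varphi$ and the last follows $\mathfrak R$; in $\mathcal H^{(\gamma;\psi)}\langle a;b\rangle$ the first $a$ entries follow $\gamma$ and the last $b$ follow $\psi$. **Order of a recruiter.** For a recruiter $C_\ell\in\dot{\mathcal C}_i$ in state $S_i$, with $V_j$ the residual recruitment time of $C_j\in\dot{\mathcal C}_i$, $O(C_\ell)=1+\sum_{j\ne\ell}\mathbf 1_{V_j\dot{\preceq}V_\ell}$, i.e. the position of $C_\ell$'s residual recruitment time in the $\dot{\preceq}$-ordered list of residual recruitment times. *)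

theory Defs
  imports "HOL-Probability.Probability"
begin

section \<open>Event dynamic variables\<close>

text \<open>
  Being an EDV, its duration, its reducer and its pivot depend on how a random variable is
  written as a difference, not only on its values. Positive random variables are therefore
  terms over named basic random variables \<open>q\<close>, interpreted by \<open>Q q :: 'w \<Rightarrow> real\<close>.
  A term \<open>Diff M N\<close> is an EDV; \<open>Base q\<close> and sums are SRVs.
\<close>

datatype 'q rv = Base 'q | Sum "'q rv" "'q rv" | Diff "'q rv" "'q rv"

primrec val :: "('q \<Rightarrow> 'w \<Rightarrow> real) \<Rightarrow> 'q rv \<Rightarrow> 'w \<Rightarrow> real" where
  "val Q (Base q) \<omega> = Q q \<omega>"
| "val Q (Sum V W) \<omega> = val Q V \<omega> + val Q W \<omega>"
| "val Q (Diff M N) \<omega> = val Q M \<omega> - val Q N \<omega>"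

definition is_edv :: "'q rv \<Rightarrow> bool" where
  "is_edv V \<longleftrightarrow> (\<exists>M N. V = Diff M N)"

primrec duration :: "'q rv \<Rightarrow> 'q rv" where
  "duration (Base q) = Base q"
| "duration (Sum V W) = Sum V W"
| "duration (Diff M N) = duration M"

primrec reducer :: "('q \<Rightarrow> 'w \<Rightarrow> real) \<Rightarrow> 'q rv \<Rightarrow> 'w \<Rightarrow> real" where
  "reducer Q (Base q) \<omega> = 0"
| "reducer Q (Sum V W) \<omega> = 0"
| "reducer Q (Diff M N) \<omega> = reducer Q M \<omega> + (val Q N \<omega> + reducer Q N \<omega>)"

definition pivot :: "('q \<Rightarrow> 'w \<Rightarrow> real) \<Rightarrow> 'q rv \<Rightarrow> 'w \<Rightarrow> real" where
  "pivot Q V \<omega> = val Q V \<omega> + reducer Q V \<omega> - val Q (duration V) \<omega>"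

text \<open>
  Residual times only make sense on the event \<open>A\<close> that a given history of the system occurs,
  so (in)equalities between random variables are required at every outcome in \<open>A\<close>.
  \<open>proper Q A V\<close> collects the side conditions \<open>M, N > 0\<close> and \<open>M > N\<close> of all differences in \<open>V\<close>.
\<close>

primrec proper :: "('q \<Rightarrow> 'w \<Rightarrow> real) \<Rightarrow> 'w set \<Rightarrow> 'q rv \<Rightarrow> bool" where
  "proper Q A (Base q) \<longleftrightarrow> (\<forall>\<omega>\<in>A. 0 < Q q \<omega>)"
| "proper Q A (Sum V W) \<longleftrightarrow> proper Q A V \<and> proper Q A W"
| "proper Q A (Diff M N) \<longleftrightarrow> proper Q A M \<and> proper Q A N \<and> (\<forall>\<omega>\<in>A. val Q N \<omega> < val Q M \<omega>)"

text \<open>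
  Durations are compared as named variables: two recruitment durations with the same constant
  value still count as different.
\<close>

definition edv_le :: "('q \<Rightarrow> 'w \<Rightarrow> real) \<Rightarrow> 'w set \<Rightarrow> 'q rv \<Rightarrow> 'q rv \<Rightarrow> bool" where
  "edv_le Q A V1 V2 \<longleftrightarrow> is_edv V1 \<and>
     (\<not> is_edv V2 \<or>
      (duration V1 \<noteq> duration V2 \<and>
       (\<forall>\<omega>\<in>A. reducer Q V1 \<omega> = reducer Q V2 \<omega> \<and> pivot Q V1 \<omega> \<le> pivot Q V2 \<omega>)))"

text \<open>\<open>V\<close> and \<open>V'\<close> are the same random variable on \<open>A\<close>, with the same duration.\<close>

definition same_rv :: "('q \<Rightarrow> 'w \<Rightarrow> real) \<Rightarrow> 'w set \<Rightarrow> 'q rv \<Rightarrow> 'q rv \<Rightarrow> bool" where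
  "same_rv Q A V V' \<longleftrightarrow> (\<forall>\<omega>\<in>A. val Q V \<omega> = val Q V' \<omega>) \<and> duration V = duration V'"

section \<open>Special e-distributions\<close>

definition indep :: "'w measure \<Rightarrow> ('q \<Rightarrow> 'w \<Rightarrow> real) \<Rightarrow> 'q rv list \<Rightarrow> bool" where
  "indep P Q Vs \<longleftrightarrow>
     prob_space.indep_vars P (\<lambda>_. borel) (\<lambda>k. val Q (Vs ! k)) {..<length Vs}"

definition srv :: "'w measure \<Rightarrow> ('q \<Rightarrow> 'w \<Rightarrow> real) \<Rightarrow> real measure \<Rightarrow> 'w set \<Rightarrow> 'q rv \<Rightarrow> bool" where
  "srv P Q D A V \<longleftrightarrow> (\<exists>q. V = Base q \<and> distr P borel (Q q) = D) \<and> proper Q A V"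

definition xdot :: "'w measure \<Rightarrow> ('q \<Rightarrow> 'w \<Rightarrow> real) \<Rightarrow> real measure \<Rightarrow> 'w set \<Rightarrow> 'q rv \<Rightarrow> bool" where
  "xdot P Q DZ A V \<longleftrightarrow> proper Q A V \<and>
     (\<exists>Z1 Z2. V = Diff Z1 Z2 \<and> srv P Q DZ A Z1 \<and> srv P Q DZ A Z2 \<and> indep P Q [Z1, Z2])"

definition xddot :: "'w measure \<Rightarrow> ('q \<Rightarrow> 'w \<Rightarrow> real) \<Rightarrow> real measure \<Rightarrow> real measure \<Rightarrow> 'w set
    \<Rightarrow> 'q rv \<Rightarrow> bool" where
  "xddot P Q DZ RU A V \<longleftrightarrow> proper Q A V \<and>
     (\<exists>Z1 Z2 U. V = Diff Z1 (Sum Z2 U) \<and> srv P Q DZ A Z1 \<and> srv P Q DZ A Z2 \<and> srv P Q RU A U \<and>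
        indep P Q [Z1, Z2, U])"

definition phi :: "'w measure \<Rightarrow> ('q \<Rightarrow> 'w \<Rightarrow> real) \<Rightarrow> real measure \<Rightarrow> real measure \<Rightarrow> 'w set
    \<Rightarrow> 'q rv \<Rightarrow> bool" where
  "phi P Q DZ RU A V \<longleftrightarrow> proper Q A V \<and>
     (\<exists>U Z'. V = Diff U Z' \<and> srv P Q RU A U \<and> xdot P Q DZ A Z' \<and> indep P Q [U, Z'])"

definition psi :: "'w measure \<Rightarrow> ('q \<Rightarrow> 'w \<Rightarrow> real) \<Rightarrow> real measure \<Rightarrow> real measure \<Rightarrow> 'w set
    \<Rightarrow> 'q rv \<Rightarrow> bool" where
  "psi P Q DZ RU A V \<longleftrightarrow> proper Q A V \<and>
     (\<exists>U W. V = Diff U W \<and> srv P Q RU A U \<and> phi P Q DZ RU A W \<and> indep P Q [U, W])"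

definition gam :: "'w measure \<Rightarrow> ('q \<Rightarrow> 'w \<Rightarrow> real) \<Rightarrow> real measure \<Rightarrow> real measure \<Rightarrow> 'w set
    \<Rightarrow> 'q rv \<Rightarrow> bool" where
  "gam P Q DZ RU A V \<longleftrightarrow> proper Q A V \<and>
     (\<exists>W U. V = Diff W U \<and> phi P Q DZ RU A W \<and> srv P Q RU A U \<and> indep P Q [W, U])"

section \<open>Event dynamic lists and H-states\<close>

definition list_le :: "('q \<Rightarrow> 'w \<Rightarrow> real) \<Rightarrow> 'w set \<Rightarrow> 'q rv list \<Rightarrow> 'q rv list \<Rightarrow> bool" where
  "list_le Q A L1 L2 \<longleftrightarrow> (\<forall>V\<in>set L1. \<forall>V'\<in>set L2. edv_le Q A V V')"

definition edl :: "('q \<Rightarrow> 'w \<Rightarrow> real) \<Rightarrow> 'w set \<Rightarrow> ('w set \<Rightarrow> 'q rv \<Rightarrow> bool) \<Rightarrow> nat \<Rightarrow> 'q rv list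
    \<Rightarrow> bool" where
  "edl Q A \<alpha> m L \<longleftrightarrow> length L = m \<and> (\<forall>V\<in>set L. \<alpha> A V) \<and> sorted_wrt (edv_le Q A) L"

definition edh :: "('q \<Rightarrow> 'w \<Rightarrow> real) \<Rightarrow> 'w set \<Rightarrow> ('w set \<Rightarrow> 'q rv \<Rightarrow> bool)
    \<Rightarrow> ('w set \<Rightarrow> 'q rv \<Rightarrow> bool) \<Rightarrow> nat \<Rightarrow> nat \<Rightarrow> 'q rv list \<Rightarrow> bool" where
  "edh Q A \<alpha> \<alpha>' a b H \<longleftrightarrow>
     (\<exists>L1 L2. H = L1 @ L2 \<and> edl Q A \<alpha> a L1 \<and> edl Q A \<alpha>' b L2 \<and> list_le Q A L1 L2)"

definition hstate :: "'w measure \<Rightarrow> ('q \<Rightarrow> 'w \<Rightarrow> real) \<Rightarrow> real measure \<Rightarrow> real measure \<Rightarrow> nat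
    \<Rightarrow> 'w set \<Rightarrow> nat \<Rightarrow> nat \<Rightarrow> ('q rv list \<times> 'q rv list) set" where
  "hstate P Q DZ RU n A i j =
    (if i = 0 \<and> j = 0 then
       {(L, []) | L. length L = 2 * n \<and> (\<forall>V\<in>set L. srv P Q DZ A V) \<and> indep P Q L}
     else if i = 0 \<and> j = 1 then
       {(L, []) | L. edl Q A (xddot P Q DZ RU) (2 * n) L}
     else if 1 \<le> i \<and> i \<le> n \<and> j = 0 then
       {(L, H). edl Q A (xdot P Q DZ) (2 * n - i) L \<and>
                edh Q A (phi P Q DZ RU) (srv P Q RU) (i - 1) 1 H \<and> list_le Q A L H}
     else if 1 \<le> i \<and> i \<le> n - 1 \<and> 1 \<le> j \<and> j \<le> i + 1 then
       {(L, H). edl Q A (xddot P Q DZ RU) (2 * n - i) L \<and>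
                edh Q A (gam P Q DZ RU) (psi P Q DZ RU) (j - 1) (i - (j - 1)) H \<and> list_le Q A L H}
     else {})"

definition hlabels :: "nat \<Rightarrow> nat \<Rightarrow> nat set" where
  "hlabels n i = (if i < n then {0..i + 1} else {0})"

section \<open>The vehicular cloud\<close>

datatype 'v clock = Sojourn 'v | Recruit 'v

datatype 'v event = Departs 'v | Recruits 'v

datatype smp_state = St nat | Failed

text \<open>
  \<open>soj\<close> gives the residual sojourn time of every vehicle that was in the cloud at the start,
  including those not (yet) processing a group; \<open>rec\<close> is the residual recruitment duration,
  meaningful for recruiters only. \<open>outcomes\<close> is the event that the history
  leading to the configuration occurs.
\<close>

record ('v, 'w) config =
  groups :: "nat \<Rightarrow> 'v set"
  soj :: "'v \<Rightarrow> 'v clock rv"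
  rec :: "'v \<Rightarrow> 'v clock rv"
  outcomes :: "'w set"

definition singles :: "nat \<Rightarrow> ('v, 'w) config \<Rightarrow> 'v set" where
  "singles n c = (\<Union>g\<in>{g. g < n \<and> card (groups c g) = 1}. groups c g)"

definition doubles :: "nat \<Rightarrow> ('v, 'w) config \<Rightarrow> 'v set" where
  "doubles n c = (\<Union>g\<in>{g. g < n \<and> card (groups c g) = 2}. groups c g)"

definition smp_state :: "nat \<Rightarrow> ('v, 'w) config \<Rightarrow> smp_state" where
  "smp_state n c = (if \<exists>g<n. groups c g = {} then Failed
                    else St (card {g. g < n \<and> card (groups c g) = 1}))"

definition initial :: "'w measure \<Rightarrow> (nat \<Rightarrow> 'v set) \<Rightarrow> ('v, 'w) config" where
  "initial P G = \<lparr>groups = G, soj = (\<lambda>l. Base (Sojourn l)), rec = (\<lambda>l. Base (Recruit l)),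
                  outcomes = space P\<rparr>"

fun residual :: "('v, 'w) config \<Rightarrow> 'v event \<Rightarrow> 'v clock rv" where
  "residual c (Departs l) = soj c l"
| "residual c (Recruits l) = rec c l"

definition active :: "nat \<Rightarrow> ('v, 'w) config \<Rightarrow> 'v event set" where
  "active n c = Departs ` (singles n c \<union> doubles n c) \<union> Recruits ` singles n c"

text \<open>
  Event \<open>e\<close> occurs next at those outcomes where its residual time is strictly smaller than that
  of every other active event. Each recruitment starts with the full duration, so the residual
  time of a vehicle that is not a recruiter is reset.
\<close>

definition elapse :: "nat \<Rightarrow> ('v clock \<Rightarrow> 'w \<Rightarrow> real) \<Rightarrow> 'v event \<Rightarrow> ('v, 'w) config
    \<Rightarrow> ('v, 'w) config" where
  "elapse n Q e c = c\<lparr>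
     soj := (\<lambda>l. Diff (soj c l) (residual c e)),
     rec := (\<lambda>l. if l \<in> singles n c then Diff (rec c l) (residual c e) else Base (Recruit l)),
     outcomes := {\<omega> \<in> outcomes c. \<forall>e'\<in>active n c - {e}.
                    val Q (residual c e) \<omega> < val Q (residual c e') \<omega>}\<rparr>"

text \<open>
  A recruiter \<open>l\<close> may recruit any vehicle \<open>r\<close> that processes no group and whose sojourn time,
  measured from the start of processing, has not expired. Which one is left open.
\<close>

inductive step :: "nat \<Rightarrow> ('v clock \<Rightarrow> 'w \<Rightarrow> real) \<Rightarrow> ('v, 'w) config \<Rightarrow> 'v event
    \<Rightarrow> ('v, 'w) config \<Rightarrow> bool" for n Q where
  departure:
    "\<lbrakk>smp_state n c \<noteq> Failed; g < n; l \<in> groups c g;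
      c' = (elapse n Q (Departs l) c)\<lparr>groups := (groups c)(g := groups c g - {l})\<rparr>\<rbrakk>
     \<Longrightarrow> step n Q c (Departs l) c'"
| recruitment:
    "\<lbrakk>smp_state n c \<noteq> Failed; g < n; groups c g = {l}; r \<notin> singles n c \<union> doubles n c;
      d = elapse n Q (Recruits l) c;
      c' = d\<lparr>groups := (groups c)(g := {l, r}),
             outcomes := {\<omega> \<in> outcomes d. 0 < val Q (soj d r) \<omega>}\<rparr>\<rbrakk>
     \<Longrightarrow> step n Q c (Recruits l) c'"

text \<open>Only histories that are realised by some outcome are considered.\<close>

inductive reachable :: "'w measure \<Rightarrow> ('v clock \<Rightarrow> 'w \<Rightarrow> real) \<Rightarrow> nat \<Rightarrow> (nat \<Rightarrow> 'v set)
    \<Rightarrow> ('v, 'w) config \<Rightarrow> bool" for P Q n G where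
  start: "reachable P Q n G (initial P G)"
| next_event: "\<lbrakk>reachable P Q n G c; step n Q c e c'; outcomes c' \<noteq> {}\<rbrakk> \<Longrightarrow> reachable P Q n G c'"

text \<open>
  \<open>in_hstate P Q DZ RU n c i j Rs Rr\<close>: configuration \<open>c\<close> is in the H-state with indices \<open>i, j\<close>,
  where \<open>Rs l\<close> and \<open>Rr l\<close> are the representations of the residual sojourn and recruitment times
  of vehicle \<open>l\<close>. They are the same random variables, with the same durations, as the
  residual times in \<open>c\<close>, which the dynamics produces as iterated differences,
  e.g. \<open>(Z1 - Z2) - (Z3 - Z2)\<close> in place of \<open>Z1 - Z3\<close>.
\<close>

definition in_hstate :: "'w measure \<Rightarrow> ('v clock \<Rightarrow> 'w \<Rightarrow> real) \<Rightarrow> real measure \<Rightarrow> real measure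
    \<Rightarrow> nat \<Rightarrow> ('v, 'w) config \<Rightarrow> nat \<Rightarrow> nat \<Rightarrow> ('v \<Rightarrow> 'v clock rv) \<Rightarrow> ('v \<Rightarrow> 'v clock rv) \<Rightarrow> bool"
  where
  "in_hstate P Q DZ RU n c i j Rs Rr \<longleftrightarrow>
     smp_state n c = St i \<and>
     (\<forall>l\<in>singles n c \<union> doubles n c. same_rv Q (outcomes c) (soj c l) (Rs l)) \<and>
     (\<forall>l\<in>singles n c. same_rv Q (outcomes c) (rec c l) (Rr l)) \<and>
     (\<exists>ls ms. distinct ls \<and> set ls = singles n c \<union> doubles n c \<and>
              distinct ms \<and> set ms = singles n c \<and>
              (map Rs ls, map Rr ms) \<in> hstate P Q DZ RU n (outcomes c) i j)"

definition recruiter_order :: "nat \<Rightarrow> ('v clock \<Rightarrow> 'w \<Rightarrow> real) \<Rightarrow> ('v, 'w) config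
    \<Rightarrow> ('v \<Rightarrow> 'v clock rv) \<Rightarrow> 'v \<Rightarrow> nat" where
  "recruiter_order n Q c Rr l =
     1 + card {m \<in> singles n c - {l}. edv_le Q (outcomes c) (Rr m) (Rr l)}"

end

theory Submission
  imports Defs
begin

text \<open>
  At elapsed time \<open>T\<close>, a residual sojourn time is \<open>Z\<^sub>v - T\<close> and the residual recruitment time of
  \<open>m\<close>, whose partner \<open>d m\<close> departed, is \<open>U\<^sub>m - (T - Z\<^bsub>d m\<^esub>)\<close>. In the canonical representations
  below the reducer is \<open>T\<close> and the pivot is the time at which the clock was started, namely \<open>0\<close> for
  sojourn times and \<open>Z\<^bsub>d m\<^esub>\<close> for recruitments; hence the order of EDVs is the order of starting
  times. After a departure of \<open>x\<close>, \<open>T = Z\<^sub>x\<close> and the residual recruitment time is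
  \<open>U\<^sub>m - (Z\<^sub>x - Z\<^bsub>d m\<^esub>)\<close>. After a recruitment by \<open>l\<close>, \<open>T = Z\<^bsub>d l\<^esub> + U\<^sub>l\<close>, and it is
  \<open>(U\<^sub>m - (Z\<^bsub>d l\<^esub> - Z\<^bsub>d m\<^esub>)) - U\<^sub>l\<close> if \<open>m\<close> started before \<open>l\<close> (a \<open>\<gamma>\<close>-EDV) and
  \<open>U\<^sub>m - (U\<^sub>l - (Z\<^bsub>d m\<^esub> - Z\<^bsub>d l\<^esub>))\<close> if it started after \<open>l\<close> (a \<open>\<psi>\<close>-EDV). So the position
  of \<open>l\<close> among the recruiters determines the H-state.
\<close>

section \<open>Sorted lists, pivots of equal random variables, and independence of terms\<close>

lemma sorted_wrt_distinct_pairwise: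
  assumes "distinct xs" and "\<And>x y. x \<in> set xs \<Longrightarrow> y \<in> set xs \<Longrightarrow> x \<noteq> y \<Longrightarrow> R x y"
  shows "sorted_wrt R xs"
  using assms by (induction xs) auto

lemma sorted_wrt_connex:
  assumes "sorted_wrt R xs" "x \<in> set xs" "y \<in> set xs" "x \<noteq> y"
  shows "R x y \<or> R y x"
  using assms by (induction xs) auto

text \<open>Value and duration do not depend on the chosen representation, so the pivot does only
  through the reducer. When two representations have equal reducers, these cancel from a comparison
  of pivots.\<close>

lemma pivot_same_rv:
  "same_rv Q A V V' \<Longrightarrow> \<omega> \<in> A \<Longrightarrow>
   pivot Q V' \<omega> = val Q V \<omega> + reducer Q V' \<omega> - val Q (duration V) \<omega>"
  by (simp add: same_rv_def pivot_def)

lemma val_measurable: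
  assumes "set_rv V \<subseteq> K"
  shows "(\<lambda>x. val (\<lambda>q x. x q) V x) \<in> borel_measurable (PiM K (\<lambda>_. borel))"
  using assms
proof (induction V)
  case (Base q)
  then show ?case by simp
next
  case (Sum V W)
  then have "(\<lambda>x. val (\<lambda>q x. x q) V x + val (\<lambda>q x. x q) W x) \<in> borel_measurable (PiM K (\<lambda>_. borel))"
    by (intro borel_measurable_add) auto
  then show ?case by simp
next
  case (Diff V W)
  then have "(\<lambda>x. val (\<lambda>q x. x q) V x - val (\<lambda>q x. x q) W x) \<in> borel_measurable (PiM K (\<lambda>_. borel))"
    by (intro borel_measurable_diff) auto
  then show ?case by simp
qed

lemma val_restrict:
  "set_rv V \<subseteq> K \<Longrightarrow> val (\<lambda>q x. x q) V (restrict (\<lambda>q. Q q \<omega>) K) = val Q V \<omega>"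
  by (induction V) auto

text \<open>Terms without common clocks are measurable functions of disjoint blocks of an
  independent family. This is the source of every independence claim in the e-distributions.\<close>

lemma (in prob_space) indep_disjoint_terms:
  assumes "indep_vars (\<lambda>_. borel) Q UNIV"
    and "sorted_wrt (\<lambda>V W. set_rv V \<inter> set_rv W = {}) Vs"
  shows "indep M Q Vs"
proof -
  let ?K = "\<lambda>k. set_rv (Vs ! k)"
  have "disjoint_family_on ?K {..<length Vs}"
    unfolding disjoint_family_on_def
  proof (intro ballI impI)
    fix a b assume "a \<in> {..<length Vs}" "b \<in> {..<length Vs}" "a \<noteq> b"
    then show "?K a \<inter> ?K b = {}"
      using assms(2) unfolding sorted_wrt_iff_nth_less
      by (cases a b rule: linorder_cases) (auto simp: Int_commute)
  qed
  then have "indep_vars (\<lambda>k. PiM (?K k) (\<lambda>_. borel)) (\<lambda>k \<omega>. restrict (\<lambda>q. Q q \<omega>) (?K k))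
      {..<length Vs}"
    by (intro indep_vars_restrict[OF assms(1)]) auto
  \<comment> \<open>Evaluation with the clocks read as coordinates of the point \<open>x\<close>
    turns each block of clocks into the value of its term.\<close>
  from indep_vars_compose2[OF this, of "\<lambda>k x. val (\<lambda>q x. x q) (Vs ! k) x" "\<lambda>_. borel"]
  show ?thesis
    by (simp add: val_measurable val_restrict indep_def)
qed

section \<open>Disjointness of the H-states\<close>

text \<open>The subtrahend is a \<open>Base\<close> in one form and a \<open>Sum\<close> in the
  other. Disjointness is thus decided by the shape of the representation, even where the laws
  coincide.\<close>

lemma xdot_xddot: "xdot P Q DZ A V \<Longrightarrow> \<not> xddot P Q DZ RU A V"
  by (auto simp: xdot_def xddot_def srv_def)

lemma srv_xddot: "srv P Q DZ' A V \<Longrightarrow> \<not> xddot P Q DZ RU A V"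
  by (auto simp: xddot_def srv_def)

text \<open>The minuend is a \<open>Diff\<close> for \<gamma> and a \<open>Base\<close> for
  \<psi>.\<close>

lemma gam_psi: "gam P Q DZ RU A V \<Longrightarrow> \<not> psi P Q DZ RU A V"
  by (auto simp: gam_def psi_def phi_def srv_def)

text \<open>If \<open>a < a'\<close> were two lengths of the first block, entry \<open>a\<close>
  would belong to the second block of one decomposition and to the first block of the other.\<close>

lemma edh_unique_split:
  assumes "edh Q A \<alpha> \<alpha>' a b H" "edh Q A \<alpha> \<alpha>' a' b' H" "\<And>V. \<alpha> A V \<Longrightarrow> \<not> \<alpha>' A V"
  shows "a = a'"
proof -
  have *: "\<not> a < a'"
    if H: "edh Q A \<alpha> \<alpha>' a b H" "edh Q A \<alpha> \<alpha>' a' b' H" for a b a' b'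
  proof
    assume "a < a'"
    obtain L1 L2 where L: "H = L1 @ L2" "edl Q A \<alpha> a L1" "edl Q A \<alpha>' b L2"
      using H(1) by (auto simp: edh_def)
    obtain K1 K2 where K: "H = K1 @ K2" "edl Q A \<alpha> a' K1" "edl Q A \<alpha>' b' K2"
      using H(2) by (auto simp: edh_def)
    have len: "a < length H" using K \<open>a < a'\<close> by (simp add: edl_def)
    then have "H ! a \<in> set L2" using L by (auto simp: nth_append edl_def)
    moreover have "H ! a \<in> set K1" using K \<open>a < a'\<close> by (auto simp: nth_append edl_def)
    ultimately show False using L K assms(3) by (auto simp: edl_def)
  qed
  from *[OF assms(1,2)] *[OF assms(2,1)] show ?thesis by simp
qed

text \<open>The sojourn list separates label 0 from all others. Two positive labels are separated by
  the number of \<gamma>-entries in the recruitment list, which is the label minus 1.\<close>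

lemma hstate_disjoint:
  assumes "i < n"
  shows "disjoint_family_on (hstate P Q DZ RU n A i) (hlabels n i)"
proof -
  have *: "hstate P Q DZ RU n A i j \<inter> hstate P Q DZ RU n A i k = {}"
    if "j < k" "k \<le> i + 1" for j k
  proof (rule ccontr)
    assume "\<not> ?thesis"
    then obtain L H where j: "(L, H) \<in> hstate P Q DZ RU n A i j"
      and k: "(L, H) \<in> hstate P Q DZ RU n A i k"
      by auto
    from k that assms have xddot: "\<forall>V\<in>set L. xddot P Q DZ RU A V" and "length L = 2 * n - i"
      by (auto simp: hstate_def edl_def split: if_splits)
    \<comment> \<open>Since \<open>i < n\<close>, the length \<open>2 * n - i\<close> is positive,
      so there is an entry whose form can be inspected.\<close>
    with assms obtain V where V: "V \<in> set L" "xddot P Q DZ RU A V"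
      by (cases L) auto
    show False
    proof (cases "j = 0")
      case True
      with j assms V show False
        by (auto simp: hstate_def edl_def split: if_splits dest: xdot_xddot srv_xddot)
    next
      case False
      with that have "1 \<le> i" by simp
      with False j k that assms have
        "edh Q A (gam P Q DZ RU) (psi P Q DZ RU) (j - 1) (i - (j - 1)) H"
        "edh Q A (gam P Q DZ RU) (psi P Q DZ RU) (k - 1) (i - (k - 1)) H"
        by (simp_all add: hstate_def split: if_splits)
      from edh_unique_split[OF this gam_psi] False that show False by simp
    qed
  qed
  show ?thesis
    unfolding disjoint_family_on_def
  proof (intro ballI impI)
    fix j k assume "j \<in> hlabels n i" "k \<in> hlabels n i" "j \<noteq> k"
    with assms *[of j k] *[of k j] show
      "hstate P Q DZ RU n A i j \<inter> hstate P Q DZ RU n A i k = {}"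
      by (cases j k rule: linorder_cases) (auto simp: hlabels_def Int_commute)
  qed
qed

lemma hstate_sorted:
  assumes "(L, H) \<in> hstate P Q DZ RU n A i k" "1 \<le> i"
  shows "sorted_wrt (edv_le Q A) H"
  using assms
  by (auto simp: hstate_def edh_def edl_def list_le_def sorted_wrt_append split: if_splits)

text \<open>Rules out sums: an entry that is not an EDV is a single clock, and its duration then
  identifies it.\<close>

lemma hstate_recruitment_entry:
  assumes "(L, H) \<in> hstate P Q DZ RU n A i k" "1 \<le> i" "V \<in> set H"
  shows "is_edv V \<or> (\<exists>q. V = Base q)"
proof -
  have "phi P Q DZ RU A V \<or> gam P Q DZ RU A V \<or> psi P Q DZ RU A V \<or> srv P Q RU A V"
    using assms by (auto simp: hstate_def edh_def edl_def split: if_splits)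
  then show ?thesis
    by (auto simp: is_edv_def srv_def phi_def gam_def psi_def)
qed

section \<open>Vehicles of a configuration\<close>

lemma mem_singles: "v \<in> singles n c \<longleftrightarrow> (\<exists>g<n. groups c g = {v})"
  by (auto simp: singles_def card_1_singleton_iff)

lemma mem_doubles: "v \<in> doubles n c \<longleftrightarrow> (\<exists>g<n. v \<in> groups c g \<and> card (groups c g) = 2)"
  by (auto simp: doubles_def)

lemma vehicles_eq:
  assumes "\<forall>g<n. card (groups c g) \<in> {1, 2}"
  shows "singles n c \<union> doubles n c = (\<Union>g<n. groups c g)"
  using assms by (auto simp: singles_def doubles_def)

lemma card_singles:
  assumes "disjoint_family_on (groups c) {..<n}"
  shows "card (singles n c) = card {g. g < n \<and> card (groups c g) = 1}"
proof -
  have "card (singles n c) = (\<Sum>g\<in>{g. g < n \<and> card (groups c g) = 1}. card (groups c g))"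
    unfolding singles_def using assms
    by (intro card_UN_disjoint) (auto simp: disjoint_family_on_def intro: card_ge_0_finite)
  then show ?thesis by simp
qed

lemma card_vehicles:
  assumes "\<forall>g<n. card (groups c g) \<in> {1, 2}" "disjoint_family_on (groups c) {..<n}"
  shows "finite (\<Union>g<n. groups c g)"
    and "card (\<Union>g<n. groups c g) = 2 * n - card (singles n c)"
proof -
  \<comment> \<open>An infinite set has cardinality 0, so sizes 1 and 2 force finiteness.\<close>
  have fin: "finite (groups c g)" if "g < n" for g
    using assms(1) that by (intro card_ge_0_finite) force
  then show "finite (\<Union>g<n. groups c g)" by auto
  let ?S = "{g. g < n \<and> card (groups c g) = 1}"
  have "card (\<Union>g<n. groups c g) = (\<Sum>g<n. card (groups c g))"
    using assms fin by (intro card_UN_disjoint) (auto simp: disjoint_family_on_def)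
  \<comment> \<open>Adding 1 for each group of size 1 raises every summand to 2; the additive form
    avoids truncated subtraction.\<close>
  moreover have "(\<Sum>g<n. card (groups c g)) + card ?S = (\<Sum>g<n. 2)"
  proof -
    have "card ?S = (\<Sum>g<n. if card (groups c g) = 1 then 1 else 0)"
      by (simp add: sum.If_cases lessThan_def Collect_conj_eq)
    then have "(\<Sum>g<n. card (groups c g)) + card ?S =
        (\<Sum>g<n. card (groups c g) + (if card (groups c g) = 1 then 1 else 0))"
      by (simp only: sum.distrib)
    also have "\<dots> = (\<Sum>g<n. 2)" using assms(1) by (intro sum.cong) auto
    finally show ?thesis .
  qed
  ultimately show "card (\<Union>g<n. groups c g) = 2 * n - card (singles n c)"
    using card_singles[OF assms(2)] by simp
qed

section \<open>Evolution of the residual times\<close>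

locale vehicular_cloud = prob_space P for P :: "'w measure" +
  fixes Q :: "'v clock \<Rightarrow> 'w \<Rightarrow> real"
    and DZ RU :: "real measure"
    and n :: nat
    and G :: "nat \<Rightarrow> 'v set"
  assumes indep_clocks: "indep_vars (\<lambda>_. borel) Q UNIV"
    and sojourn_distr: "\<And>l. distr P borel (Q (Sojourn l)) = DZ"
    and recruit_distr: "\<And>l. distr P borel (Q (Recruit l)) = RU"
    and positive: "\<And>q \<omega>. \<omega> \<in> space P \<Longrightarrow> 0 < Q q \<omega>"
    and two_vehicles: "\<And>g. g < n \<Longrightarrow> card (G g) = 2"
    and one_group: "disjoint_family_on G {..<n}"
begin

lemmas indep_terms = indep_disjoint_terms[OF indep_clocks]

abbreviation Z :: "'v \<Rightarrow> 'w \<Rightarrow> real" where "Z l \<equiv> Q (Sojourn l)"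
abbreviation U :: "'v \<Rightarrow> 'w \<Rightarrow> real" where "U l \<equiv> Q (Recruit l)"
abbreviation bZ :: "'v \<Rightarrow> 'v clock rv" where "bZ l \<equiv> Base (Sojourn l)"
abbreviation bU :: "'v \<Rightarrow> 'v clock rv" where "bU l \<equiv> Base (Recruit l)"

section \<open>Canonical differences of clocks follow the special e-distributions\<close>

lemma srvI:
  assumes "A \<subseteq> space P"
  shows "srv P Q DZ A (bZ l)" "srv P Q RU A (bU l)"
  using assms by (auto simp: srv_def sojourn_distr recruit_distr intro: positive)

context
  fixes A :: "'w set"
  assumes A: "A \<subseteq> space P" "A \<noteq> {}"
begin

lemma xdotI:
  assumes "\<forall>\<omega>\<in>A. Z b \<omega> < Z a \<omega>"
  shows "xdot P Q DZ A (Diff (bZ a) (bZ b))"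
proof -
  \<comment> \<open>Independence needs two different clocks. With \<open>a = b\<close> the strict
    inequality would fail at any outcome of the nonempty set \<open>A\<close>.\<close>
  have "a \<noteq> b" using assms A by auto
  then have "indep P Q [bZ a, bZ b]" by (intro indep_terms) auto
  with assms A show ?thesis by (auto simp: xdot_def srvI intro: positive)
qed

lemma xddotI:
  assumes "\<forall>\<omega>\<in>A. Z b \<omega> + U l \<omega> < Z a \<omega>"
  shows "xddot P Q DZ RU A (Diff (bZ a) (Sum (bZ b) (bU l)))"
proof -
  obtain \<omega> where "\<omega> \<in> A" using A by auto
  then have "a \<noteq> b" using assms A positive[of \<omega> "Recruit l"] by force
  then have "indep P Q [bZ a, bZ b, bU l]" by (intro indep_terms) auto
  with assms A show ?thesis by (auto simp: xddot_def srvI intro: positive)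
qed

lemma phiI:
  assumes "\<forall>\<omega>\<in>A. Z b \<omega> < Z a \<omega>" "\<forall>\<omega>\<in>A. Z a \<omega> - Z b \<omega> < U m \<omega>"
  shows "phi P Q DZ RU A (Diff (bU m) (Diff (bZ a) (bZ b)))"
proof -
  have "indep P Q [bU m, Diff (bZ a) (bZ b)]" by (intro indep_terms) auto
  with assms A show ?thesis by (auto simp: phi_def srvI xdotI intro: positive)
qed

text \<open>Two recruitment clocks occur, and the inequality between their values does not exclude
  \<open>m = l\<close>, so distinctness is assumed. Sojourn and recruitment clocks differ already by
  their constructor.\<close>

lemma psiI:
  assumes "m \<noteq> l" "\<forall>\<omega>\<in>A. Z b \<omega> < Z a \<omega>" "\<forall>\<omega>\<in>A. Z a \<omega> - Z b \<omega> < U l \<omega>"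
    and "\<forall>\<omega>\<in>A. U l \<omega> - (Z a \<omega> - Z b \<omega>) < U m \<omega>"
  shows "psi P Q DZ RU A (Diff (bU m) (Diff (bU l) (Diff (bZ a) (bZ b))))"
proof -
  have "indep P Q [bU m, Diff (bU l) (Diff (bZ a) (bZ b))]"
    using assms(1) by (intro indep_terms) auto
  with assms A show ?thesis by (auto simp: psi_def srvI phiI intro: positive)
qed

lemma gamI:
  assumes "m \<noteq> l" "\<forall>\<omega>\<in>A. Z b \<omega> < Z a \<omega>" "\<forall>\<omega>\<in>A. Z a \<omega> - Z b \<omega> < U m \<omega>"
    and "\<forall>\<omega>\<in>A. U l \<omega> < U m \<omega> - (Z a \<omega> - Z b \<omega>)"
  shows "gam P Q DZ RU A (Diff (Diff (bU m) (Diff (bZ a) (bZ b))) (bU l))"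
proof -
  have "indep P Q [Diff (bU m) (Diff (bZ a) (bZ b)), bU l]"
    using assms(1) by (intro indep_terms) auto
  with assms A show ?thesis by (auto simp: gam_def srvI phiI intro: positive)
qed

end

text \<open>
  \<open>T\<close> is the time elapsed since processing started, \<open>d m\<close> the departed partner of recruiter \<open>m\<close>
  (so \<open>m\<close> has been recruiting since time \<open>Z (d m)\<close>), and \<open>ms\<close> lists the recruiters by
  starting time.
\<close>

definition timed :: "('v, 'w) config \<Rightarrow> ('w \<Rightarrow> real) \<Rightarrow> ('v \<Rightarrow> 'v) \<Rightarrow> 'v list \<Rightarrow> bool" where
  "timed c T d ms \<longleftrightarrow>
     outcomes c \<subseteq> space P \<and> outcomes c \<noteq> {} \<and>
     (\<forall>g<n. card (groups c g) \<in> {1, 2}) \<and> disjoint_family_on (groups c) {..<n} \<and>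
     distinct ms \<and> set ms = singles n c \<and>
     (\<forall>l. duration (soj c l) = bZ l) \<and> (\<forall>l\<in>set ms. duration (rec c l) = bU l) \<and>
     (\<forall>\<omega>\<in>outcomes c.
        (\<forall>l. val Q (soj c l) \<omega> = Z l \<omega> - T \<omega>) \<and>
        (\<forall>l\<in>singles n c \<union> doubles n c. T \<omega> < Z l \<omega>) \<and>
        (\<forall>m\<in>set ms. val Q (rec c m) \<omega> = U m \<omega> - (T \<omega> - Z (d m) \<omega>) \<and>
           T \<omega> < Z (d m) \<omega> + U m \<omega> \<and> Z (d m) \<omega> \<le> T \<omega>) \<and>
        sorted_wrt (\<lambda>a b. Z (d a) \<omega> < Z (d b) \<omega>) ms)"

section \<open>State index and number of vehicles of a timed configuration\<close>

lemma timedD: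
  assumes "timed c T d ms"
  shows timed_groups: "\<forall>g<n. card (groups c g) \<in> {1, 2}" "disjoint_family_on (groups c) {..<n}"
    and timed_recruiters: "distinct ms" "set ms = singles n c"
  using assms unfolding timed_def by blast+

lemma timed_card:
  assumes "timed c T d ms"
  shows "card (singles n c) = length ms" "smp_state n c = St (length ms)" "length ms \<le> n"
proof -
  show l: "card (singles n c) = length ms"
    using timed_recruiters[OF assms] by (metis distinct_card)
  have "groups c g \<noteq> {}" if "g < n" for g using timed_groups(1)[OF assms] that by force
  moreover have c: "card {g. g < n \<and> card (groups c g) = 1} = length ms"
    using l card_singles[OF timed_groups(2)[OF assms]] by simp
  ultimately show "smp_state n c = St (length ms)" by (auto simp: smp_state_def)
  have "card {g. g < n \<and> card (groups c g) = 1} \<le> card {..<n}" by (intro card_mono) auto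
  with c show "length ms \<le> n" by simp
qed

lemma timed_vehicles:
  assumes "timed c T d ms"
  obtains ls where "distinct ls" "set ls = singles n c \<union> doubles n c"
    "length ls = 2 * n - length ms"
proof -
  note g = timed_groups[OF assms]
  obtain ls where "distinct ls" "set ls = (\<Union>g<n. groups c g)"
    using finite_distinct_list[OF card_vehicles(1)[OF g]] by auto
  with that[of ls] card_vehicles(2)[OF g] timed_card[OF assms] vehicles_eq[OF g(1)]
  show thesis by (metis distinct_card)
qed

section \<open>Timed configurations at the start, after a departure and after a recruitment lie in
  H-states\<close>

text \<open>At time 0 there are no recruiters, so \<open>d\<close> is arbitrary. Independence of the
  sojourn list holds because distinct vehicles own distinct clocks.\<close>

lemma in_hstate_initial: "\<exists>Rs Rr. in_hstate P Q DZ RU n (initial P G) 0 0 Rs Rr"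
  and timed_initial: "timed (initial P G) (\<lambda>_. 0) d []"
proof -
  have s: "singles n (initial P G) = {}"
    using two_vehicles by (force simp: singles_def initial_def)
  show t: "timed (initial P G) (\<lambda>_. 0) d []"
    using s two_vehicles one_group not_empty
    by (auto simp: timed_def initial_def intro: positive)
  obtain ls where ls: "distinct ls" "set ls = singles n (initial P G) \<union> doubles n (initial P G)"
    "length ls = 2 * n"
    using timed_vehicles[OF t] by auto
  have "indep P Q (map bZ ls)"
    using ls(1) by (intro indep_terms) (auto simp: sorted_wrt_map intro!: sorted_wrt_distinct_pairwise)
  then have "in_hstate P Q DZ RU n (initial P G) 0 0 bZ bU"
    unfolding in_hstate_def using ls s timed_card[OF t]
    by (auto simp: same_rv_def initial_def hstate_def srvI intro!: exI[of _ ls])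
  then show "\<exists>Rs Rr. in_hstate P Q DZ RU n (initial P G) 0 0 Rs Rr" by blast
qed

text \<open>Here \<open>d p\<close> is the vehicle that has just left and \<open>p\<close> its
  former partner. The recruiters in \<open>ms\<close> started earlier and give \<phi>-EDVs;
  \<open>p\<close> retains its full duration and, as an SRV, comes last by convention.\<close>

lemma in_hstate_departure:
  assumes t: "timed c T d (ms @ [p])" and T: "\<forall>\<omega>\<in>outcomes c. T \<omega> = Z (d p) \<omega>"
  shows "\<exists>Rs Rr. in_hstate P Q DZ RU n c (Suc (length ms)) 0 Rs Rr"
proof -
  let ?A = "outcomes c"
  define Rs where "Rs v = Diff (bZ v) (bZ (d p))" for v
  define Rr where "Rr m = (if m = p then bU p else Diff (bU m) (Diff (bZ (d p)) (bZ (d m))))" for m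
  have A: "?A \<subseteq> space P" "?A \<noteq> {}" using t by (auto simp: timed_def)
  have nonneg: "0 \<le> Q q \<omega>" if "\<omega> \<in> ?A" for q \<omega>
    using positive[of \<omega> q] A that by fastforce
  obtain ls where ls: "distinct ls" "set ls = singles n c \<union> doubles n c"
    "length ls = 2 * n - Suc (length ms)"
    using timed_vehicles[OF t] by auto
  have ms: "distinct ms" "p \<notin> set ms" "set (ms @ [p]) = singles n c"
    using t by (auto simp: timed_def)
  \<comment> \<open>All sojourn entries have reducer \<open>Z (d p)\<close> and pivot 0, so the list
    is ordered however the vehicles are enumerated.\<close>
  have L: "edl Q ?A (xdot P Q DZ) (2 * n - Suc (length ms)) (map Rs ls)"
    unfolding edl_def using ls t T
    by (auto simp: Rs_def timed_def sorted_wrt_map edv_le_def is_edv_def pivot_def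
        intro!: xdotI[OF A] sorted_wrt_distinct_pairwise)
  have "sorted_wrt (edv_le Q ?A) (map Rr ms)"
    unfolding sorted_wrt_iff_nth_less
  proof (intro allI impI)
    fix a b assume ab: "a < b" "b < length (map Rr ms)"
    then have "ms ! a \<noteq> ms ! b" "ms ! a \<noteq> p" "ms ! b \<noteq> p"
      using ms by (auto simp: nth_eq_iff_index_eq)
    moreover have "Z (d (ms ! a)) \<omega> < Z (d (ms ! b)) \<omega>" if "\<omega> \<in> ?A" for \<omega>
    proof -
      have "sorted_wrt (\<lambda>a b. Z (d a) \<omega> < Z (d b) \<omega>) ms"
        using t that by (auto simp: timed_def sorted_wrt_append)
      with ab show ?thesis unfolding sorted_wrt_iff_nth_less by simp
    qed
    ultimately show "edv_le Q ?A (map Rr ms ! a) (map Rr ms ! b)"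
      using ab by (auto simp: Rr_def edv_le_def is_edv_def pivot_def less_imp_le)
  qed
  moreover have "phi P Q DZ RU ?A (Rr m)" if "m \<in> set ms" for m
  proof -
    have "m \<noteq> p" using that ms by auto
    moreover have "\<forall>\<omega>\<in>?A. Z (d m) \<omega> < Z (d p) \<omega> \<and> T \<omega> < Z (d m) \<omega> + U m \<omega>"
      using t that by (auto simp: timed_def sorted_wrt_append)
    then have "phi P Q DZ RU ?A (Diff (bU m) (Diff (bZ (d p)) (bZ (d m))))"
      using T by (intro phiI[OF A]) force+
    ultimately show ?thesis by (simp add: Rr_def)
  qed
  ultimately have "edl Q ?A (phi P Q DZ RU) (length ms) (map Rr ms)"
    by (auto simp: edl_def)
  moreover have "edl Q ?A (srv P Q RU) 1 [bU p]" by (simp add: edl_def srvI A)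
  moreover have "list_le Q ?A (map Rr ms) [bU p]"
    using ms by (auto simp: list_le_def edv_le_def is_edv_def Rr_def)
  ultimately have H: "edh Q ?A (phi P Q DZ RU) (srv P Q RU) (length ms) 1 (map Rr (ms @ [p]))"
    unfolding edh_def by (intro exI[of _ "map Rr ms"] exI[of _ "[bU p]"]) (simp add: Rr_def)
  \<comment> \<open>Reducers agree, and the sojourn pivot 0 is below the recruitment pivots, which
    are nonnegative starting times.\<close>
  have "list_le Q ?A (map Rs ls) (map Rr (ms @ [p]))"
    by (auto simp: list_le_def edv_le_def is_edv_def Rs_def Rr_def pivot_def nonneg)
  with L H timed_card(3)[OF t]
  have "(map Rs ls, map Rr (ms @ [p])) \<in> hstate P Q DZ RU n ?A (Suc (length ms)) 0"
    by (auto simp: hstate_def)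
  moreover have "\<forall>v. same_rv Q ?A (soj c v) (Rs v)"
    using t T by (auto simp: same_rv_def timed_def Rs_def)
  moreover have "\<forall>m\<in>singles n c. same_rv Q ?A (rec c m) (Rr m)"
    using t T unfolding ms(3)[symmetric] by (auto simp: same_rv_def timed_def Rr_def)
  moreover have "distinct (ms @ [p])" using ms by simp
  ultimately have "in_hstate P Q DZ RU n c (Suc (length ms)) 0 Rs Rr"
    unfolding in_hstate_def using ls ms(3) timed_card(2)[OF t] by (metis length_append_singleton)
  then show ?thesis by blast
qed

text \<open>Here \<open>l\<close> has just finished recruiting and \<open>x\<close> is its departed
  partner. The recruiters in \<open>ms1\<close> started before \<open>l\<close>, those in
  \<open>ms2\<close> after it, so the former give the \<gamma>-block and the latter the
  \<psi>-block.\<close>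

lemma in_hstate_recruitment:
  assumes t: "timed c T d (ms1 @ ms2)" and l: "l \<notin> set (ms1 @ ms2)"
    and T: "\<forall>\<omega>\<in>outcomes c. T \<omega> = Z x \<omega> + U l \<omega>"
    and ms1: "\<forall>\<omega>\<in>outcomes c. \<forall>m\<in>set ms1. Z (d m) \<omega> < Z x \<omega>"
    and ms2: "\<forall>\<omega>\<in>outcomes c. \<forall>m\<in>set ms2. Z x \<omega> < Z (d m) \<omega> \<and> Z (d m) \<omega> < T \<omega>"
    and less: "length (ms1 @ ms2) < n"
  shows "\<exists>Rs Rr. in_hstate P Q DZ RU n c (length (ms1 @ ms2)) (Suc (length ms1)) Rs Rr"
proof -
  let ?A = "outcomes c" and ?i = "length (ms1 @ ms2)"
  define Rs where "Rs v = Diff (bZ v) (Sum (bZ x) (bU l))" for v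
  define Rr where "Rr m = (if m \<in> set ms1 then Diff (Diff (bU m) (Diff (bZ x) (bZ (d m)))) (bU l)
    else Diff (bU m) (Diff (bU l) (Diff (bZ (d m)) (bZ x))))" for m
  have A: "?A \<subseteq> space P" "?A \<noteq> {}" using t by (auto simp: timed_def)
  have nonneg: "0 \<le> Q q \<omega>" if "\<omega> \<in> ?A" for q \<omega>
    using positive[of \<omega> q] A that by fastforce
  obtain ls where ls: "distinct ls" "set ls = singles n c \<union> doubles n c"
    "length ls = 2 * n - ?i"
    using timed_vehicles[OF t] by auto
  have ms: "distinct (ms1 @ ms2)" "set (ms1 @ ms2) = singles n c"
    using t by (auto simp: timed_def)
  \<comment> \<open>Both forms yield the same reducer and have the starting time as pivot, so one
    ordering argument covers both blocks and their junction.\<close>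
  have r: "reducer Q (Rr m) \<omega> = Z x \<omega> + U l \<omega>" "pivot Q (Rr m) \<omega> = Z (d m) \<omega>"
    "duration (Rr m) = bU m" "is_edv (Rr m)" for m \<omega>
    by (auto simp: Rr_def pivot_def is_edv_def)
  have L: "edl Q ?A (xddot P Q DZ RU) (2 * n - ?i) (map Rs ls)"
    unfolding edl_def using ls t T
    by (auto simp: Rs_def timed_def sorted_wrt_map edv_le_def is_edv_def pivot_def
        intro!: xddotI[OF A] sorted_wrt_distinct_pairwise)
  have sorted: "sorted_wrt (edv_le Q ?A) (map Rr (ms1 @ ms2))"
    unfolding sorted_wrt_iff_nth_less
  proof (intro allI impI)
    fix a b assume ab: "a < b" "b < length (map Rr (ms1 @ ms2))"
    then have "(ms1 @ ms2) ! a \<noteq> (ms1 @ ms2) ! b"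
      using ms(1) by (metis length_map nth_eq_iff_index_eq less_trans less_irrefl)
    moreover have "Z (d ((ms1 @ ms2) ! a)) \<omega> < Z (d ((ms1 @ ms2) ! b)) \<omega>" if "\<omega> \<in> ?A" for \<omega>
    proof -
      have "sorted_wrt (\<lambda>a b. Z (d a) \<omega> < Z (d b) \<omega>) (ms1 @ ms2)"
        using t that by (auto simp: timed_def)
      with ab show ?thesis unfolding sorted_wrt_iff_nth_less by simp
    qed
    ultimately have "edv_le Q ?A (Rr ((ms1 @ ms2) ! a)) (Rr ((ms1 @ ms2) ! b))"
      by (auto simp: edv_le_def r less_imp_le)
    then show "edv_le Q ?A (map Rr (ms1 @ ms2) ! a) (map Rr (ms1 @ ms2) ! b)"
      using ab by (metis length_map nth_map less_trans)
  qed
  have "gam P Q DZ RU ?A (Rr m)" if m: "m \<in> set ms1" for m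
  proof -
    \<comment> \<open>With \<open>T = Z x + U l\<close>, the first bound rearranges to
      \<open>U l < U m - (Z x - Z (d m))\<close>; positivity of \<open>U l\<close> then gives
      \<open>Z x - Z (d m) < U m\<close>.\<close>
    have "\<forall>\<omega>\<in>?A. T \<omega> < Z (d m) \<omega> + U m \<omega> \<and> 0 < U l \<omega>"
      using t m A by (auto simp: timed_def intro: positive)
    then have "gam P Q DZ RU ?A (Diff (Diff (bU m) (Diff (bZ x) (bZ (d m)))) (bU l))"
      using T m ms1 l by (intro gamI[OF A]) force+
    with m show ?thesis by (simp add: Rr_def)
  qed
  with sorted have H1: "edl Q ?A (gam P Q DZ RU) (length ms1) (map Rr ms1)"
    by (auto simp: edl_def sorted_wrt_append)
  have "psi P Q DZ RU ?A (Rr m)" if m: "m \<in> set ms2" for m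
  proof -
    have "\<forall>\<omega>\<in>?A. T \<omega> < Z (d m) \<omega> + U m \<omega>"
      using t m by (auto simp: timed_def)
    then have "psi P Q DZ RU ?A (Diff (bU m) (Diff (bU l) (Diff (bZ (d m)) (bZ x))))"
      using T m ms2 l by (intro psiI[OF A]) force+
    moreover have "m \<notin> set ms1" using m ms(1) by auto
    ultimately show ?thesis by (simp add: Rr_def)
  qed
  with sorted have H2: "edl Q ?A (psi P Q DZ RU) (length ms2) (map Rr ms2)"
    by (auto simp: edl_def sorted_wrt_append)
  have "list_le Q ?A (map Rr ms1) (map Rr ms2)"
    using sorted by (auto simp: sorted_wrt_append list_le_def)
  with H1 H2 have H: "edh Q ?A (gam P Q DZ RU) (psi P Q DZ RU) (length ms1) (length ms2)
      (map Rr (ms1 @ ms2))"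
    unfolding edh_def by auto
  have "list_le Q ?A (map Rs ls) (map Rr (ms1 @ ms2))"
    by (auto simp: list_le_def edv_le_def r) (auto simp: Rs_def is_edv_def pivot_def nonneg)
  with L H less
  have "(map Rs ls, map Rr (ms1 @ ms2)) \<in> hstate P Q DZ RU n ?A ?i (Suc (length ms1))"
    \<comment> \<open>With no recruiter left, both blocks are empty and the label is 1 in state 0,
      which is a separate clause of \<open>hstate\<close>.\<close>
    by (cases "?i = 0") (auto simp: hstate_def Suc_le_eq)
  moreover have "\<forall>v. same_rv Q ?A (soj c v) (Rs v)"
    using t T by (auto simp: same_rv_def timed_def Rs_def)
  moreover have "\<forall>m\<in>singles n c. same_rv Q ?A (rec c m) (Rr m)"
    using t T unfolding ms(2)[symmetric] by (auto simp: same_rv_def timed_def Rr_def)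
  ultimately have "in_hstate P Q DZ RU n c ?i (Suc (length ms1)) Rs Rr"
    unfolding in_hstate_def using ls ms timed_card(2)[OF t] by metis
  then show ?thesis by blast
qed

section \<open>Transitions preserve the timed description\<close>

text \<open>Taking \<open>l\<close> from a group of two excludes failure. The new elapsed time is
  \<open>Z l\<close>, and the partner \<open>p\<close> of \<open>l\<close> joins the end of the
  recruiter list, since it starts last.\<close>

lemma timed_departure:
  assumes t: "timed c T d ms" and st: "step n Q c (Departs l) c'" and ne: "outcomes c' \<noteq> {}"
    and l: "l \<in> doubles n c"
  obtains T' d' ms' where "timed c' T' d' ms'"
    "\<exists>Rs Rr. in_hstate P Q DZ RU n c' (Suc (length ms)) 0 Rs Rr"
proof -
  from st obtain g where g: "g < n" "l \<in> groups c g"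
    and c': "c' = (elapse n Q (Departs l) c)\<lparr>groups := (groups c)(g := groups c g - {l})\<rparr>"
    by cases auto
  have dis: "a = b" if "a < n" "b < n" "v \<in> groups c a" "v \<in> groups c b" for a b v
  proof -
    from disjoint_family_onD[OF timed_groups(2)[OF t], of a b] that show ?thesis by blast
  qed
  obtain g' where "g' < n" "l \<in> groups c g'" "card (groups c g') = 2"
    using l by (auto simp: mem_doubles)
  then have "card (groups c g) = 2"
    using dis[OF g(1) _ g(2)] by metis
  then obtain x y where "groups c g = {x, y}" "x \<noteq> y" by (auto simp: card_2_iff)
  with g(2) obtain p where p: "groups c g = {l, p}" "p \<noteq> l"
    by (metis insertE insert_commute singletonD)
  have gr: "groups c' = (groups c)(g := {p})"
    using p by (auto simp: c' elapse_def)
  have gne: "groups c g' = {v} \<Longrightarrow> g' \<noteq> g" for g' v using p by auto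
  have singles: "singles n c' = insert p (singles n c)"
  proof (rule set_eqI)
    fix v
    have "(\<exists>g'<n. groups c' g' = {v}) \<longleftrightarrow> v = p \<or> (\<exists>g'<n. groups c g' = {v})"
      using g(1) gne by (metis fun_upd_apply gr singleton_inject)
    then show "v \<in> singles n c' \<longleftrightarrow> v \<in> insert p (singles n c)"
      by (simp add: mem_singles)
  qed
  have pn: "p \<notin> singles n c" "p \<in> doubles n c"
  proof -
    show "p \<in> doubles n c" using g p by (auto simp: mem_doubles)
    show "p \<notin> singles n c"
    proof
      assume "p \<in> singles n c"
      then obtain g' where "g' < n" "groups c g' = {p}" by (auto simp: mem_singles)
      with dis[OF g(1), of g' p] p show False by auto
    qed
  qed
  have g12: "\<forall>g<n. card (groups c g) \<in> {1, 2}" and g12': "\<forall>g<n. card (groups c' g) \<in> {1, 2}"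
    using t by (auto simp: timed_def gr)
  have disj': "disjoint_family_on (groups c') {..<n}"
    unfolding disjoint_family_on_def
  proof (intro ballI impI)
    have sub: "groups c' k \<subseteq> groups c k" for k using p by (simp add: gr)
    fix a b assume "a \<in> {..<n}" "b \<in> {..<n}" "a \<noteq> b"
    from disjoint_family_onD[OF timed_groups(2)[OF t] this] sub
    show "groups c' a \<inter> groups c' b = {}" by blast
  qed
  have veh: "singles n c' \<union> doubles n c' \<subseteq> singles n c \<union> doubles n c - {l}"
    unfolding vehicles_eq[OF g12] vehicles_eq[OF g12']
  proof
    fix v assume "v \<in> (\<Union>g<n. groups c' g)"
    then obtain g' where g': "g' < n" "v \<in> groups c' g'" by auto
    show "v \<in> (\<Union>g<n. groups c g) - {l}"
    proof (cases "g' = g")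
      case True
      with g' p g(1) show ?thesis by (auto simp: gr)
    next
      case False
      with g' have "v \<in> groups c g'" by (simp add: gr)
      with dis[OF g(1) g'(1) g(2)] False g'(1) show ?thesis by auto
    qed
  qed
  let ?d = "d(p := l)"
  have t': "timed c' (Z l) ?d (ms @ [p])"
  proof -
    \<comment> \<open>The defining inequalities between residual times become inequalities between
      absolute times, as the common \<open>T\<close> cancels.\<close>
    have o: "\<omega> \<in> outcomes c" "\<forall>v\<in>singles n c \<union> doubles n c - {l}. Z l \<omega> < Z v \<omega>"
      "\<forall>m\<in>set ms. Z l \<omega> < Z (d m) \<omega> + U m \<omega>" "T \<omega> < Z l \<omega>"
      if "\<omega> \<in> outcomes c'" for \<omega>
    proof -
      from that show \<omega>: "\<omega> \<in> outcomes c" by (simp add: c' elapse_def)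
      from that have o: "\<forall>e'\<in>active n c - {Departs l}. val Q (soj c l) \<omega> < val Q (residual c e') \<omega>"
        by (simp add: c' elapse_def)
      show "\<forall>v\<in>singles n c \<union> doubles n c - {l}. Z l \<omega> < Z v \<omega>"
      proof
        fix v assume "v \<in> singles n c \<union> doubles n c - {l}"
        then show "Z l \<omega> < Z v \<omega>"
          using bspec[OF o, of "Departs v"] \<omega> t by (auto simp: timed_def active_def)
      qed
      show "\<forall>m\<in>set ms. Z l \<omega> < Z (d m) \<omega> + U m \<omega>"
      proof
        fix m assume "m \<in> set ms"
        then show "Z l \<omega> < Z (d m) \<omega> + U m \<omega>"
          using bspec[OF o, of "Recruits m"] \<omega> t by (auto simp: timed_def active_def)
      qed
      show "T \<omega> < Z l \<omega>" using \<omega> t l by (auto simp: timed_def)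
    qed
    have ms: "m \<noteq> p" "m \<in> singles n c" if "m \<in> set ms" for m using that pn t by (auto simp: timed_def)
    \<comment> \<open>\<open>Z (d m) \<le> T\<close> and \<open>T < Z l\<close> give strictness,
      which keeps starting times strictly increasing once \<open>p\<close> is appended.\<close>
    have start: "Z (d m) \<omega> < Z l \<omega>" if "m \<in> set ms" "\<omega> \<in> outcomes c'" for m \<omega>
      using that o(1,4)[OF that(2)] t by (force simp: timed_def)
    have 1: "outcomes c' \<subseteq> space P" using t o(1) by (auto simp: timed_def)
    have 2: "distinct (ms @ [p])" "set (ms @ [p]) = singles n c'"
      using t pn singles by (auto simp: timed_def)
    have 3: "\<forall>l. duration (soj c' l) = bZ l" "\<forall>l\<in>set (ms @ [p]). duration (rec c' l) = bU l"
      using t pn by (auto simp: timed_def c' elapse_def)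
    have 4: "\<forall>v. val Q (soj c' v) \<omega> = Z v \<omega> - Z l \<omega>" if "\<omega> \<in> outcomes c'" for \<omega>
      using t o(1)[OF that] by (auto simp: timed_def c' elapse_def)
    have 5: "\<forall>m\<in>set (ms @ [p]). val Q (rec c' m) \<omega> = U m \<omega> - (Z l \<omega> - Z (?d m) \<omega>) \<and>
           Z l \<omega> < Z (?d m) \<omega> + U m \<omega> \<and> Z (?d m) \<omega> \<le> Z l \<omega>" if "\<omega> \<in> outcomes c'" for \<omega>
    proof -
      have "0 < U p \<omega>" using 1 that by (auto intro: positive)
      \<comment> \<open>Since \<open>p\<close> was not a recruiter before the event,
        \<open>elapse\<close> gives it the full duration.\<close>
      moreover have "val Q (rec c' p) \<omega> = U p \<omega>" using pn by (simp add: c' elapse_def)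
      moreover have "val Q (rec c' m) \<omega> = U m \<omega> - (Z l \<omega> - Z (d m) \<omega>)" if "m \<in> set ms" for m
        using ms[OF that] that t o(1)[OF \<open>\<omega> \<in> outcomes c'\<close>] by (auto simp: timed_def c' elapse_def)
      ultimately show ?thesis
        using o(3)[OF that] start[OF _ that] ms by (auto simp: less_imp_le)
    qed
    have 6: "sorted_wrt (\<lambda>a b. Z (?d a) \<omega> < Z (?d b) \<omega>) (ms @ [p])" if "\<omega> \<in> outcomes c'" for \<omega>
    proof -
      have "sorted_wrt (\<lambda>a b. Z (d a) \<omega> < Z (d b) \<omega>) ms"
        using t o(1)[OF that] by (auto simp: timed_def)
      then have "sorted_wrt (\<lambda>a b. Z (?d a) \<omega> < Z (?d b) \<omega>) ms"
        by (rule sorted_wrt_mono_rel[rotated]) (use ms in auto)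
      then show ?thesis using start[OF _ that] ms by (auto simp: sorted_wrt_append)
    qed
    have 7: "\<forall>v\<in>singles n c' \<union> doubles n c'. Z l \<omega> < Z v \<omega>" if "\<omega> \<in> outcomes c'" for \<omega>
      using veh o(2)[OF that] by (meson subsetD)
    show ?thesis
      unfolding timed_def
      by (intro conjI ballI[where A = "outcomes c'"] 1 2 3 4 5 6 7 ne g12' disj'; assumption)
  qed
  from in_hstate_departure[OF this] that[OF this] show thesis by simp
qed

text \<open>The recruiter list loses only \<open>l\<close>, and \<open>d\<close> stays valid for the
  rest. The recruit \<open>r\<close> was in the cloud from the start, so its residual sojourn time
  has the common form \<open>Z r - T\<close>; its positivity is part of the new outcomes.\<close>

lemma timed_recruitment:
  assumes t: "timed c T d (ms1 @ l # ms2)" and st: "step n Q c (Recruits l) c'"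
    and ne: "outcomes c' \<noteq> {}"
  obtains T' where "timed c' T' d (ms1 @ ms2)" "length (ms1 @ ms2) < n"
    "\<exists>Rs Rr. in_hstate P Q DZ RU n c' (length (ms1 @ ms2)) (Suc (length ms1)) Rs Rr"
proof -
  from st obtain g r where g: "g < n" "groups c g = {l}" and r: "r \<notin> singles n c \<union> doubles n c"
    and c': "c' = (elapse n Q (Recruits l) c)\<lparr>groups := (groups c)(g := {l, r}),
             outcomes := {\<omega> \<in> outcomes (elapse n Q (Recruits l) c).
               0 < val Q (soj (elapse n Q (Recruits l) c) r) \<omega>}\<rparr>"
    by cases auto
  have dis: "a = b" if "a < n" "b < n" "v \<in> groups c a" "v \<in> groups c b" for a b v
  proof -
    from disjoint_family_onD[OF timed_groups(2)[OF t], of a b] that show ?thesis by blast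
  qed
  have ls: "l \<in> singles n c" using g by (auto simp: mem_singles)
  with r have rl: "r \<noteq> l" by auto
  have gr: "groups c' = (groups c)(g := {l, r})" by (simp add: c')
  have g12: "\<forall>g<n. card (groups c g) \<in> {1, 2}" and g12': "\<forall>g<n. card (groups c' g) \<in> {1, 2}"
    using t rl by (auto simp: timed_def gr)
  have rn: "r \<notin> groups c g'" if "g' < n" for g'
    using r that unfolding vehicles_eq[OF g12] by auto
  have singles: "singles n c' = singles n c - {l}"
  proof (rule set_eqI)
    fix v
    have "(\<exists>k<n. groups c' k = {v}) \<longleftrightarrow> (\<exists>k<n. groups c k = {v}) \<and> v \<noteq> l"
    proof
      assume "\<exists>k<n. groups c' k = {v}"
      then obtain k where k: "k < n" "groups c' k = {v}" by auto
      then have kg: "k \<noteq> g" using rl by (auto simp: gr)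
      with k have "groups c k = {v}" by (simp add: gr)
      moreover from this have "v \<noteq> l" using dis[OF k(1) g(1), of l] g(2) kg by auto
      ultimately show "(\<exists>k<n. groups c k = {v}) \<and> v \<noteq> l" using k by blast
    next
      assume "(\<exists>k<n. groups c k = {v}) \<and> v \<noteq> l"
      then obtain k where "k < n" "groups c k = {v}" "v \<noteq> l" by auto
      moreover from this have "k \<noteq> g" using g(2) by auto
      ultimately show "\<exists>k<n. groups c' k = {v}" by (intro exI[of _ k]) (simp add: gr)
    qed
    then show "v \<in> singles n c' \<longleftrightarrow> v \<in> singles n c - {l}" by (simp add: mem_singles)
  qed
  have disj': "disjoint_family_on (groups c') {..<n}"
    unfolding disjoint_family_on_def
  proof (intro ballI impI)
    fix a b assume ab: "a \<in> {..<n}" "b \<in> {..<n}" "a \<noteq> b"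
    then have "groups c a \<inter> groups c b = {}"
      by (rule disjoint_family_onD[OF timed_groups(2)[OF t]])
    then show "groups c' a \<inter> groups c' b = {}"
      using rn[of a] rn[of b] ab g(2) by (cases "a = g"; cases "b = g") (auto simp: gr)
  qed
  have veh: "singles n c' \<union> doubles n c' \<subseteq> insert r (singles n c \<union> doubles n c)"
    unfolding vehicles_eq[OF g12] vehicles_eq[OF g12']
    using g by (auto simp: gr split: if_splits)
  \<comment> \<open>The new elapsed time is \<open>T\<close> plus the residual duration
    \<open>U l - (T - Z (d l))\<close>.\<close>
  let ?T = "\<lambda>\<omega>. Z (d l) \<omega> + U l \<omega>"
  have o: "\<omega> \<in> outcomes c" "\<forall>v\<in>insert r (singles n c \<union> doubles n c). ?T \<omega> < Z v \<omega>"
    "\<forall>m\<in>set (ms1 @ ms2). ?T \<omega> < Z (d m) \<omega> + U m \<omega>" "T \<omega> < ?T \<omega>"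
    if "\<omega> \<in> outcomes c'" for \<omega>
  proof -
    from that show \<omega>: "\<omega> \<in> outcomes c" by (simp add: c' elapse_def)
    from that have o: "\<forall>e'\<in>active n c - {Recruits l}. val Q (rec c l) \<omega> < val Q (residual c e') \<omega>"
      by (simp add: c' elapse_def)
    have l: "val Q (rec c l) \<omega> = U l \<omega> - (T \<omega> - Z (d l) \<omega>)"
      using \<omega> t by (auto simp: timed_def)
    show "\<forall>v\<in>insert r (singles n c \<union> doubles n c). ?T \<omega> < Z v \<omega>"
    proof
      fix v assume "v \<in> insert r (singles n c \<union> doubles n c)"
      then show "?T \<omega> < Z v \<omega>"
      proof (cases "v = r")
        case True
        have "val Q (soj c r) \<omega> = Z r \<omega> - T \<omega>" using \<omega> t by (auto simp: timed_def)
        with True that l show ?thesis by (simp add: c' elapse_def)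
      next
        case False
        with \<open>v \<in> _\<close> show ?thesis
          using bspec[OF o, of "Departs v"] \<omega> t l by (auto simp: timed_def active_def)
      qed
    qed
    show "\<forall>m\<in>set (ms1 @ ms2). ?T \<omega> < Z (d m) \<omega> + U m \<omega>"
    proof
      fix m assume m: "m \<in> set (ms1 @ ms2)"
      moreover have "m \<noteq> l" using m t by (auto simp: timed_def)
      moreover have "val Q (rec c m) \<omega> = U m \<omega> - (T \<omega> - Z (d m) \<omega>)"
        using \<omega> t m by (auto simp: timed_def)
      moreover have "m \<in> singles n c" using t m by (auto simp: timed_def)
      ultimately show "?T \<omega> < Z (d m) \<omega> + U m \<omega>"
        using bspec[OF o, of "Recruits m"] l by (auto simp: active_def)
    qed
    show "T \<omega> < ?T \<omega>" using \<omega> t by (auto simp: timed_def)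
  qed
  have start: "Z (d m) \<omega> < ?T \<omega>" if "m \<in> set (ms1 @ ms2)" "\<omega> \<in> outcomes c'" for m \<omega>
  proof -
    have "Z (d m) \<omega> \<le> T \<omega>" using that o(1)[OF that(2)] t by (auto simp: timed_def)
    with o(4)[OF that(2)] show ?thesis by simp
  qed
  have ms: "m \<in> singles n c \<and> m \<noteq> l" if "m \<in> set (ms1 @ ms2)" for m
    using that t by (auto simp: timed_def)
  have sorted: "sorted_wrt (\<lambda>a b. Z (d a) \<omega> < Z (d b) \<omega>) (ms1 @ l # ms2)"
    if "\<omega> \<in> outcomes c'" for \<omega>
    using t o(1)[OF that] by (auto simp: timed_def)
  have t': "timed c' ?T d (ms1 @ ms2)"
  proof -
    have 1: "outcomes c' \<subseteq> space P" using t o(1) by (auto simp: timed_def)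
    have 2: "distinct (ms1 @ ms2)" "set (ms1 @ ms2) = singles n c'"
      using t unfolding singles by (auto simp: timed_def)
    have 3: "\<forall>l. duration (soj c' l) = bZ l" "\<forall>m\<in>set (ms1 @ ms2). duration (rec c' m) = bU m"
      using t ms by (auto simp: timed_def c' elapse_def)
    have 4: "\<forall>v. val Q (soj c' v) \<omega> = Z v \<omega> - ?T \<omega>" if "\<omega> \<in> outcomes c'" for \<omega>
      using t o(1)[OF that] by (auto simp: timed_def c' elapse_def)
    have 5: "\<forall>m\<in>set (ms1 @ ms2). val Q (rec c' m) \<omega> = U m \<omega> - (?T \<omega> - Z (d m) \<omega>) \<and>
           ?T \<omega> < Z (d m) \<omega> + U m \<omega> \<and> Z (d m) \<omega> \<le> ?T \<omega>" if "\<omega> \<in> outcomes c'" for \<omega>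
    proof -
      have "val Q (rec c' m) \<omega> = U m \<omega> - (?T \<omega> - Z (d m) \<omega>)" if "m \<in> set (ms1 @ ms2)" for m
      proof -
        have "val Q (rec c m) \<omega> = U m \<omega> - (T \<omega> - Z (d m) \<omega>)"
          "val Q (rec c l) \<omega> = U l \<omega> - (T \<omega> - Z (d l) \<omega>)"
          using that t o(1)[OF \<open>\<omega> \<in> outcomes c'\<close>] by (auto simp: timed_def)
        with ms[OF that] show ?thesis by (auto simp: c' elapse_def)
      qed
      with o(3)[OF that] start[OF _ that] show ?thesis by (auto simp: less_imp_le)
    qed
    have 6: "sorted_wrt (\<lambda>a b. Z (d a) \<omega> < Z (d b) \<omega>) (ms1 @ ms2)" if "\<omega> \<in> outcomes c'" for \<omega>
      using sorted[OF that] by (auto simp: sorted_wrt_append)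
    have 7: "\<forall>v\<in>singles n c' \<union> doubles n c'. ?T \<omega> < Z v \<omega>" if "\<omega> \<in> outcomes c'" for \<omega>
      using veh o(2)[OF that] by (meson subsetD)
    show ?thesis
      unfolding timed_def
      by (intro conjI ballI[where A = "outcomes c'"] 1 2 3 4 5 6 7 ne g12' disj'; assumption)
  qed
  have less: "length (ms1 @ ms2) < n" using timed_card(3)[OF t] by simp
  have "\<exists>Rs Rr. in_hstate P Q DZ RU n c' (length (ms1 @ ms2)) (Suc (length ms1)) Rs Rr"
    using ms sorted start less
    by (intro in_hstate_recruitment[OF t', of l "d l"]) (auto simp: sorted_wrt_append)
  with that t' less show thesis by blast
qed

text \<open>
  All residual recruitment times have reducer \<open>T\<close> (or are just starting), so comparing them
  amounts to comparing pivots, which are the starting times.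
\<close>

lemma edv_le_start:
  assumes t: "timed c T d ms" and h: "in_hstate P Q DZ RU n c i k Rs Rr" and "1 \<le> i"
    and m: "a \<in> singles n c" "b \<in> singles n c" and le: "edv_le Q (outcomes c) (Rr a) (Rr b)"
    and \<omega>: "\<omega> \<in> outcomes c"
  shows "Z (d a) \<omega> \<le> Z (d b) \<omega>"
proof -
  from h have s: "same_rv Q (outcomes c) (rec c a) (Rr a)" "same_rv Q (outcomes c) (rec c b) (Rr b)"
    using m by (auto simp: in_hstate_def)
  have rec: "val Q (rec c v) \<omega> = U v \<omega> - (T \<omega> - Z (d v) \<omega>)" "duration (rec c v) = bU v"
    "Z (d v) \<omega> \<le> T \<omega>"
    if "v \<in> singles n c" for v
    using t that \<omega> by (auto simp: timed_def)
  show ?thesis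
  proof (cases "is_edv (Rr b)")
    case True
    with le \<omega> have "pivot Q (Rr a) \<omega> \<le> pivot Q (Rr b) \<omega>" "reducer Q (Rr a) \<omega> = reducer Q (Rr b) \<omega>"
      by (auto simp: edv_le_def)
    then show ?thesis
      unfolding pivot_same_rv[OF s(1) \<omega>] pivot_same_rv[OF s(2) \<omega>]
      using rec[OF m(1)] rec[OF m(2)] by simp
  next
    case False
    obtain L ms' where "b \<in> set ms'" "(L, map Rr ms') \<in> hstate P Q DZ RU n (outcomes c) i k"
      using h m(2) unfolding in_hstate_def by blast
    then have "\<exists>q. Rr b = Base q"
      using hstate_recruitment_entry[of L _ P Q DZ RU n "outcomes c" i k "Rr b"] False \<open>1 \<le> i\<close>
      by auto
    \<comment> \<open>This is the case where an EDV precedes an SRV by convention. The bare clock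
      shows that \<open>b\<close> is starting right now, at time \<open>T\<close>, so
      \<open>a\<close> cannot have started later.\<close>
    then have "Rr b = bU b"
      using s(2) rec(2)[OF m(2)] by (auto simp: same_rv_def)
    then have "Z (d b) \<omega> = T \<omega>"
      using s(2) rec[OF m(2)] \<omega> by (auto simp: same_rv_def)
    with rec[OF m(1)] show ?thesis by simp
  qed
qed

text \<open>The order is independent of the representation. By \<open>edv_le_start\<close> a later
  starter never precedes an earlier one, and sortedness of the H-state list makes any two recruiters
  comparable, so the earlier one does precede.\<close>

lemma recruiter_order_eq:
  assumes t: "timed c T d (ms1 @ l # ms2)" and h: "in_hstate P Q DZ RU n c i k Rs Rr" and i: "1 \<le> i"
  shows "recruiter_order n Q c Rr l = Suc (length ms1)"
proof -
  obtain L ms' where ms': "distinct ms'" "set ms' = singles n c"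
    and "(L, map Rr ms') \<in> hstate P Q DZ RU n (outcomes c) i k"
    using h unfolding in_hstate_def by blast
  then have sorted: "sorted_wrt (\<lambda>a b. edv_le Q (outcomes c) (Rr a) (Rr b)) ms'"
    using i by (auto simp: sorted_wrt_map dest: hstate_sorted)
  \<comment> \<open>A single outcome suffices: \<open>edv_le\<close> must hold at every outcome, so
    a violation at one refutes it.\<close>
  obtain \<omega> where \<omega>: "\<omega> \<in> outcomes c" using t by (auto simp: timed_def)
  have ms: "distinct (ms1 @ l # ms2)" "set (ms1 @ l # ms2) = singles n c"
    "sorted_wrt (\<lambda>a b. Z (d a) \<omega> < Z (d b) \<omega>) (ms1 @ l # ms2)"
    using t \<omega> by (auto simp: timed_def)
  have le: "\<not> edv_le Q (outcomes c) (Rr b) (Rr a)"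
    if "a \<in> singles n c" "b \<in> singles n c" "Z (d a) \<omega> < Z (d b) \<omega>" for a b
    using edv_le_start[OF t h i that(2,1) _ \<omega>] that by auto
  have "{m \<in> singles n c - {l}. edv_le Q (outcomes c) (Rr m) (Rr l)} = set ms1"
  proof (intro equalityI subsetI)
    fix m assume m: "m \<in> {m \<in> singles n c - {l}. edv_le Q (outcomes c) (Rr m) (Rr l)}"
    with ms(2) have "m \<in> set ms1 \<or> m \<in> set ms2" by auto
    with m le[of l m] ms show "m \<in> set ms1" by (auto simp: sorted_wrt_append)
  next
    fix m assume m: "m \<in> set ms1"
    with ms have *: "m \<in> singles n c" "l \<in> singles n c" "m \<noteq> l" "Z (d m) \<omega> < Z (d l) \<omega>"
      by (auto simp: sorted_wrt_append)
    with le[of m l] sorted_wrt_connex[OF sorted, of m l] ms'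
    show "m \<in> {m \<in> singles n c - {l}. edv_le Q (outcomes c) (Rr m) (Rr l)}" by auto
  qed
  then show ?thesis
    using ms(1) by (simp add: recruiter_order_def distinct_card)
qed

section \<open>Reachable configurations that have not failed\<close>

text \<open>A departing recruiter would leave its group empty, which is failure.\<close>

lemma step_vehicle:
  assumes t: "timed c T d ms" and st: "step n Q c e c'" and nf: "smp_state n c' \<noteq> Failed"
  obtains l where "e = Departs l" "l \<in> doubles n c" | l where "e = Recruits l" "l \<in> set ms"
proof -
  have nonempty: "groups c' g \<noteq> {}" if "g < n" for g
    using nf that unfolding smp_state_def by metis
  have two: "card (groups c g) = 2" if "g < n" "groups c g \<noteq> {l}" "l \<in> groups c g" for g l
  proof -
    have "card (groups c g) \<noteq> 1" using that by (auto simp: card_1_singleton_iff)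
    then show ?thesis using t that by (auto simp: timed_def)
  qed
  from st have "(\<exists>l. e = Departs l \<and> l \<in> doubles n c) \<or> (\<exists>l. e = Recruits l \<and> l \<in> singles n c)"
  proof cases
    case (departure g l)
    then have "groups c g \<noteq> {l}" using nonempty[of g] by auto
    with departure two[of g l] show ?thesis by (auto simp: mem_doubles)
  next
    case recruitment
    then show ?thesis by (auto simp: mem_singles)
  qed
  with that t show thesis by (auto simp: timed_def)
qed

lemma step_timed:
  assumes t: "timed c T d ms" and st: "step n Q c e c'" and ne: "outcomes c' \<noteq> {}"
    and nf: "smp_state n c' \<noteq> Failed"
  shows "\<exists>T' d' ms' j. timed c' T' d' ms' \<and> j \<in> hlabels n (length ms') \<and>
    (\<exists>Rs Rr. in_hstate P Q DZ RU n c' (length ms') j Rs Rr)"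
  using t st nf
proof (cases rule: step_vehicle)
  case (1 l)
  obtain T' d' ms' where t': "timed c' T' d' ms'"
    and h: "\<exists>Rs Rr. in_hstate P Q DZ RU n c' (Suc (length ms)) 0 Rs Rr"
    using timed_departure[OF t st[unfolded 1] ne 1(2)] .
  \<comment> \<open>The state index of \<open>c'\<close> is fixed by both facts, which determines
    the length of \<open>ms'\<close>.\<close>
  from h timed_card[OF t'] have "Suc (length ms) = length ms'" by (auto simp: in_hstate_def)
  note h[unfolded this]
  moreover have "0 \<in> hlabels n (length ms')" by (simp add: hlabels_def)
  ultimately show ?thesis using t' by metis
next
  case (2 l)
  then obtain ms1 ms2 where ms: "ms = ms1 @ l # ms2" by (auto simp: in_set_conv_decomp)
  obtain T' where t': "timed c' T' d (ms1 @ ms2)" "length (ms1 @ ms2) < n"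
    "\<exists>Rs Rr. in_hstate P Q DZ RU n c' (length (ms1 @ ms2)) (Suc (length ms1)) Rs Rr"
    using timed_recruitment[OF t[unfolded ms] st[unfolded 2] ne] .
  from t'(2) have "Suc (length ms1) \<in> hlabels n (length (ms1 @ ms2))"
    by (simp add: hlabels_def)
  with t'(1,3) show ?thesis by metis
qed

text \<open>No step leaves a failed configuration, so absence of failure at the end passes back
  along the whole history and the induction applies.\<close>

lemma reachable_timed:
  assumes "reachable P Q n G c" "smp_state n c \<noteq> Failed"
  shows "\<exists>T d ms j. timed c T d ms \<and> j \<in> hlabels n (length ms) \<and>
    (\<exists>Rs Rr. in_hstate P Q DZ RU n c (length ms) j Rs Rr)"
  using assms
proof induction
  case start
  show ?case
    using timed_initial[of "\<lambda>v. v"] in_hstate_initial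
    by (intro exI[of _ "\<lambda>_. 0"] exI[of _ "\<lambda>v. v"] exI[of _ "[]"] exI[of _ 0])
      (simp add: hlabels_def)
next
  case (next_event c e c')
  then have "smp_state n c \<noteq> Failed" by (auto elim: step.cases)
  with next_event.IH obtain T d ms where "timed c T d ms" by blast
  from step_timed[OF this next_event.hyps(2,3) next_event.prems] show ?case .
qed

end

section \<open>The decomposition into H-states\<close>

theorem theorem1:
  fixes P :: "'w measure"
    and Q :: "'v clock \<Rightarrow> 'w \<Rightarrow> real"
    and DZ RU :: "real measure"
    and n :: nat
    and G :: "nat \<Rightarrow> 'v set"
  assumes prob: "prob_space P"
    and indep: "prob_space.indep_vars P (\<lambda>_. borel) Q UNIV"
    and sojourn_distr: "\<And>l. distr P borel (Q (Sojourn l)) = DZ"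
    and recruit_distr: "\<And>l. distr P borel (Q (Recruit l)) = RU"
    and positive: "\<And>q \<omega>. \<omega> \<in> space P \<Longrightarrow> 0 < Q q \<omega>"
    and n: "n \<ge> 1"
    and two_vehicles: "\<And>g. g < n \<Longrightarrow> card (G g) = 2"
    and one_group: "disjoint_family_on G {..<n}"
  shows
    "(\<forall>i<n. card (hlabels n i) = i + 2 \<and>
        (\<forall>A. disjoint_family_on (hstate P Q DZ RU n A i) (hlabels n i))) \<and>
     (\<forall>c i. reachable P Q n G c \<and> smp_state n c = St i \<longrightarrow>
        i \<le> n \<and> (\<exists>j\<in>hlabels n i. \<exists>Rs Rr. in_hstate P Q DZ RU n c i j Rs Rr)) \<and>
     (\<exists>Rs Rr. in_hstate P Q DZ RU n (initial P G) 0 0 Rs Rr) \<and>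
     (\<forall>c e c'. reachable P Q n G c \<and> step n Q c e c' \<and> outcomes c' \<noteq> {} \<longrightarrow>
        (\<forall>l\<in>singles n c. smp_state n c = St 1 \<and> e = Recruits l \<longrightarrow>
           (\<exists>Rs Rr. in_hstate P Q DZ RU n c' 0 1 Rs Rr)) \<and>
        (\<forall>i. 1 \<le> i \<and> i \<le> n - 1 \<longrightarrow>
           (\<forall>l\<in>doubles n c. smp_state n c = St (i - 1) \<and> e = Departs l \<longrightarrow>
              (\<exists>Rs Rr. in_hstate P Q DZ RU n c' i 0 Rs Rr)) \<and>
           (\<forall>j\<in>{1..i + 1}. \<forall>l\<in>singles n c. \<forall>k Rs Rr.
              smp_state n c = St (i + 1) \<and> e = Recruits l \<and>
              in_hstate P Q DZ RU n c (i + 1) k Rs Rr \<and> recruiter_order n Q c Rr l = j \<longrightarrow>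
              (\<exists>Rs' Rr'. in_hstate P Q DZ RU n c' i j Rs' Rr'))) \<and>
        (\<forall>l\<in>doubles n c. smp_state n c = St (n - 1) \<and> e = Departs l \<longrightarrow>
           (\<exists>Rs Rr. in_hstate P Q DZ RU n c' n 0 Rs Rr)))"
proof -
  interpret vehicular_cloud P Q DZ RU n G
    using assms by (simp add: vehicular_cloud_def vehicular_cloud_axioms_def)
  have labels: "card (hlabels n i) = i + 2" if "i < n" for i
    using that by (simp add: hlabels_def)
  have dep: "\<exists>Rs Rr. in_hstate P Q DZ RU n c' i 0 Rs Rr"
    if a: "reachable P Q n G c" "step n Q c (Departs l) c'" "outcomes c' \<noteq> {}" "l \<in> doubles n c"
      "smp_state n c = St (i - 1)" "1 \<le> i" for c c' l i
  proof -
    obtain T d ms where t: "timed c T d ms" using reachable_timed[OF a(1)] a(5) by auto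
    with timed_card(2)[OF t] a(5,6) have "Suc (length ms) = i" by simp
    with timed_departure[OF t a(2,3,4)] show ?thesis by metis
  qed
  \<comment> \<open>Shared by both recruitment claims: for \<open>i = 0\<close> the list
    \<open>ms1\<close> is empty and the label is 1; otherwise \<open>recruiter_order_eq\<close>
    identifies \<open>Suc (length ms1)\<close> with the order of \<open>l\<close>.\<close>
  have rcr: "\<exists>ms1 ms2 T d. timed c T d (ms1 @ l # ms2) \<and> length (ms1 @ ms2) = i \<and>
      (\<exists>Rs Rr. in_hstate P Q DZ RU n c' i (Suc (length ms1)) Rs Rr)"
    if a: "reachable P Q n G c" "step n Q c (Recruits l) c'" "outcomes c' \<noteq> {}" "l \<in> singles n c"
      "smp_state n c = St (Suc i)" for c c' l i
  proof -
    obtain T d ms where t: "timed c T d ms" using reachable_timed[OF a(1)] a(5) by auto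
    then have "l \<in> set ms" using a(4) by (auto simp: timed_def)
    then obtain ms1 ms2 where ms: "ms = ms1 @ l # ms2" by (auto simp: in_set_conv_decomp)
    then have "length (ms1 @ ms2) = i" using timed_card(2)[OF t] a(5) by simp
    with timed_recruitment[OF t[unfolded ms] a(2,3)] t[unfolded ms] show ?thesis by metis
  qed
  have rec1: "\<exists>Rs Rr. in_hstate P Q DZ RU n c' 0 1 Rs Rr"
    if "reachable P Q n G c" "step n Q c (Recruits l) c'" "outcomes c' \<noteq> {}" "l \<in> singles n c"
      "smp_state n c = St 1" for c c' l
    using rcr[OF that(1-4), of 0] that(5) by auto
  have recj: "\<exists>Rs' Rr'. in_hstate P Q DZ RU n c' i (recruiter_order n Q c Rr l) Rs' Rr'"
    if "reachable P Q n G c" "step n Q c (Recruits l) c'" "outcomes c' \<noteq> {}" "l \<in> singles n c"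
      "smp_state n c = St (i + 1)" "in_hstate P Q DZ RU n c (i + 1) k Rs Rr" for c c' l i k Rs Rr
    using rcr[OF that(1-4), of i] that(5) recruiter_order_eq[OF _ that(6)] by fastforce
  have reach: "i \<le> n \<and> (\<exists>j\<in>hlabels n i. \<exists>Rs Rr. in_hstate P Q DZ RU n c i j Rs Rr)"
    if a: "reachable P Q n G c" "smp_state n c = St i" for c i
  proof -
    obtain T d ms j where t: "timed c T d ms" "j \<in> hlabels n (length ms)"
      "\<exists>Rs Rr. in_hstate P Q DZ RU n c (length ms) j Rs Rr"
      using reachable_timed[OF a(1)] a(2) by force
    with timed_card[OF t(1)] a(2) show ?thesis by auto
  qed
  show ?thesis
  proof (intro conjI allI impI ballI; (elim conjE)?)
    fix i assume "i < n"
    then show "card (hlabels n i) = i + 2" by (rule labels)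
  next
    fix i A assume "i < n"
    then show "disjoint_family_on (hstate P Q DZ RU n A i) (hlabels n i)" by (rule hstate_disjoint)
  next
    fix c i assume "reachable P Q n G c" "smp_state n c = St i"
    from reach[OF this]
    show "i \<le> n" "\<exists>j\<in>hlabels n i. \<exists>Rs Rr. in_hstate P Q DZ RU n c i j Rs Rr" by auto
  next
    show "\<exists>Rs Rr. in_hstate P Q DZ RU n (initial P G) 0 0 Rs Rr" by (rule in_hstate_initial)
  next
    fix c e c' l
    assume "reachable P Q n G c" "step n Q c e c'" "outcomes c' \<noteq> {}" "l \<in> singles n c"
      "smp_state n c = St 1" "e = Recruits l"
    then show "\<exists>Rs Rr. in_hstate P Q DZ RU n c' 0 1 Rs Rr" by (intro rec1) simp_all
  next
    fix c e c' i l
    assume "reachable P Q n G c" "step n Q c e c'" "outcomes c' \<noteq> {}" "1 \<le> i" "l \<in> doubles n c"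
      "smp_state n c = St (i - 1)" "e = Departs l"
    then show "\<exists>Rs Rr. in_hstate P Q DZ RU n c' i 0 Rs Rr" by (intro dep) simp_all
  next
    fix c e c' i j l k Rs Rr
    assume "reachable P Q n G c" "step n Q c e c'" "outcomes c' \<noteq> {}" "l \<in> singles n c"
      "smp_state n c = St (i + 1)" "e = Recruits l"
      "in_hstate P Q DZ RU n c (i + 1) k Rs Rr" "recruiter_order n Q c Rr l = j"
    then show "\<exists>Rs' Rr'. in_hstate P Q DZ RU n c' i j Rs' Rr'" using recj by blast
  next
    fix c e c' l
    assume "reachable P Q n G c" "step n Q c e c'" "outcomes c' \<noteq> {}" "l \<in> doubles n c"
      "smp_state n c = St (n - 1)" "e = Departs l"
    then show "\<exists>Rs Rr. in_hstate P Q DZ RU n c' n 0 Rs Rr" using n by (intro dep) simp_all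
  qed
qed

end
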